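(* Let $E$ be a smooth locally uniformly rotund Banach space and let $K\subset E$ be a compact subset that is not a singleton (and nonempty), equipped with the metric induced by the norm of $E$. Then the Banach space $\mathrm{Lip}(K)$ has the Daugavet property if and only if $K$ is convex.
   Context: For a metric space $(K,\rho)$, the space of all Lipschitz functions $f\colon K\to\mathbb{R}$ carries the seminorm $$\|f\|=\sup\Bigl\{\frac{|f(t_1)-f(t_2)|}{\rho(t_1,t_2)} : t_1\neq t_2\in K\Bigr\}.$$ $\mathrm{Lip}(K)$ denotes the Banach space obtained by quotienting out the constant functions (the kernel of the seminorm), with the induced norm. A Banach space $X$ has the Daugavet property if $\|\mathrm{Id}+T\|=1+\|T\|$ for every bounded rank-1 operator $T\colon X\to X$. A Banach space $(E,\|\cdot\|_E)$ with closed unit ball $B_E$ and unit sphere $S_E$ is locally uniformly rotund if for each $x\in S_E$ and $\eta>0$ there is some $\delta=\delta_x(\eta)>0$ such that $\|x-y\|_E\le\eta$ whenever $y\in B_E$ and $\|\frac12(x+y)\|_E\ge 1-\delta$. *)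

theory Defs
  imports "HOL-Analysis.Analysis"
begin

section \<open>Real Banach spaces with an explicit carrier\<close>

text \<open>
  The space \<open>Lip(K)\<close> depends on the set \<open>K\<close>, so it cannot be a type of class \<^class>\<open>banach\<close>.
\<close>

record 'v normed_struct =
  car :: "'v set"
  vzero :: 'v
  vadd :: "'v \<Rightarrow> 'v \<Rightarrow> 'v"
  vscale :: "real \<Rightarrow> 'v \<Rightarrow> 'v"
  vnorm :: "'v \<Rightarrow> real"

definition vdiff :: "'v normed_struct \<Rightarrow> 'v \<Rightarrow> 'v \<Rightarrow> 'v" where
  "vdiff X x y = vadd X x (vscale X (-1) y)"

locale banach_space_on =
  fixes X :: "'v normed_struct"
  assumes zero_closed: "vzero X \<in> car X"
    and add_closed: "\<lbrakk>x \<in> car X; y \<in> car X\<rbrakk> \<Longrightarrow> vadd X x y \<in> car X"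
    and scale_closed: "x \<in> car X \<Longrightarrow> vscale X a x \<in> car X"
    and add_assoc: "\<lbrakk>x \<in> car X; y \<in> car X; z \<in> car X\<rbrakk> \<Longrightarrow>
          vadd X (vadd X x y) z = vadd X x (vadd X y z)"
    and add_commute: "\<lbrakk>x \<in> car X; y \<in> car X\<rbrakk> \<Longrightarrow> vadd X x y = vadd X y x"
    and add_zero: "x \<in> car X \<Longrightarrow> vadd X x (vzero X) = x"
    and add_minus: "x \<in> car X \<Longrightarrow> vdiff X x x = vzero X"
    and scale_add_right: "\<lbrakk>x \<in> car X; y \<in> car X\<rbrakk> \<Longrightarrow>
          vscale X a (vadd X x y) = vadd X (vscale X a x) (vscale X a y)"
    and scale_add_left: "x \<in> car X \<Longrightarrow>
          vscale X (a + b) x = vadd X (vscale X a x) (vscale X b x)"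
    and scale_scale: "x \<in> car X \<Longrightarrow> vscale X a (vscale X b x) = vscale X (a * b) x"
    and scale_one: "x \<in> car X \<Longrightarrow> vscale X 1 x = x"
    and norm_nonneg: "x \<in> car X \<Longrightarrow> 0 \<le> vnorm X x"
    and norm_eq_zero: "x \<in> car X \<Longrightarrow> vnorm X x = 0 \<longleftrightarrow> x = vzero X"
    and norm_triangle: "\<lbrakk>x \<in> car X; y \<in> car X\<rbrakk> \<Longrightarrow>
          vnorm X (vadd X x y) \<le> vnorm X x + vnorm X y"
    and norm_scale: "x \<in> car X \<Longrightarrow> vnorm X (vscale X a x) = \<bar>a\<bar> * vnorm X x"
    and complete: "\<lbrakk>\<And>n. s n \<in> car X;
            \<And>e. e > 0 \<Longrightarrow> \<exists>N. \<forall>m\<ge>N. \<forall>n\<ge>N. vnorm X (vdiff X (s m) (s n)) < e\<rbrakk> \<Longrightarrow>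
          \<exists>x\<in>car X. (\<lambda>n::nat. vnorm X (vdiff X (s n) x)) \<longlonglongrightarrow> 0"

section \<open>The Daugavet property\<close>

definition linear_op :: "'v normed_struct \<Rightarrow> ('v \<Rightarrow> 'v) \<Rightarrow> bool" where
  "linear_op X T \<longleftrightarrow> T \<in> car X \<rightarrow> car X \<and>
    (\<forall>x\<in>car X. \<forall>y\<in>car X. T (vadd X x y) = vadd X (T x) (T y)) \<and>
    (\<forall>a. \<forall>x\<in>car X. T (vscale X a x) = vscale X a (T x))"

definition bounded_op :: "'v normed_struct \<Rightarrow> ('v \<Rightarrow> 'v) \<Rightarrow> bool" where
  "bounded_op X T \<longleftrightarrow> linear_op X T \<and> (\<exists>B. \<forall>x\<in>car X. vnorm X (T x) \<le> B * vnorm X x)"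

definition op_norm :: "'v normed_struct \<Rightarrow> ('v \<Rightarrow> 'v) \<Rightarrow> real" where
  "op_norm X T = (SUP x\<in>{x \<in> car X. vnorm X x \<le> 1}. vnorm X (T x))"

definition rank_one :: "'v normed_struct \<Rightarrow> ('v \<Rightarrow> 'v) \<Rightarrow> bool" where
  "rank_one X T \<longleftrightarrow> (\<exists>y\<in>car X. y \<noteq> vzero X \<and> T ` car X = {vscale X a y |a. True})"

definition daugavet_property :: "'v normed_struct \<Rightarrow> bool" where
  "daugavet_property X \<longleftrightarrow>
    (\<forall>T. bounded_op X T \<and> rank_one X T \<longrightarrow>
      op_norm X (\<lambda>x. vadd X x (T x)) = 1 + op_norm X T)"

section \<open>The space of Lipschitz functions modulo constants\<close>

text \<open>
  A function \<open>K \<rightarrow> \<real>\<close> is represented by a total function in \<^term>\<open>extensional K\<close>.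
\<close>

definition lip_funs :: "'a::metric_space set \<Rightarrow> ('a \<Rightarrow> real) set" where
  "lip_funs K = {f \<in> extensional K. \<exists>L. L-lipschitz_on K f}"

text \<open>
  The supremum is over a nonempty set only if \<open>K\<close> has at least two points; for other \<open>K\<close>
  the value is unspecified.
\<close>

definition lip_seminorm :: "'a::metric_space set \<Rightarrow> ('a \<Rightarrow> real) \<Rightarrow> real" where
  "lip_seminorm K f = Sup {\<bar>f s - f t\<bar> / dist s t |s t. s \<in> K \<and> t \<in> K \<and> s \<noteq> t}"

definition lip_rel :: "'a::metric_space set \<Rightarrow> (('a \<Rightarrow> real) \<times> ('a \<Rightarrow> real)) set" where
  "lip_rel K = {(f, g). f \<in> lip_funs K \<and> g \<in> lip_funs K \<and> (\<exists>c. \<forall>t\<in>K. f t - g t = c)}"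

definition Lip :: "'a::metric_space set \<Rightarrow> ('a \<Rightarrow> real) set normed_struct" where
  "Lip K = \<lparr>
     car = lip_funs K // lip_rel K,
     vzero = lip_rel K `` {\<lambda>t\<in>K. 0},
     vadd = (\<lambda>A B. \<Union>f\<in>A. \<Union>g\<in>B. lip_rel K `` {\<lambda>t\<in>K. f t + g t}),
     vscale = (\<lambda>a A. \<Union>f\<in>A. lip_rel K `` {\<lambda>t\<in>K. a * f t}),
     vnorm = (\<lambda>A. the_elem (lip_seminorm K ` A)) \<rparr>"

subsection \<open>\<open>Lip K\<close> is a Banach space\<close>

lemma lip_funs_restrict:
  "L-lipschitz_on K f \<Longrightarrow> (\<lambda>t\<in>K. f t) \<in> lip_funs K"
  unfolding lip_funs_def lipschitz_on_def by auto

lemma lip_funs_zero: "(\<lambda>t\<in>K. 0) \<in> lip_funs K"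
  by (rule lip_funs_restrict[of 0]) (rule lipschitz_on_constant)

lemma lip_funs_add:
  assumes "f \<in> lip_funs K" "g \<in> lip_funs K"
  shows "(\<lambda>t\<in>K. f t + g t) \<in> lip_funs K"
  using assms by (auto simp: lip_funs_def[of K] intro!: lip_funs_restrict[unfolded lip_funs_def] lipschitz_on_add)

lemma lip_funs_scale:
  assumes "f \<in> lip_funs K"
  shows "(\<lambda>t\<in>K. a * f t) \<in> lip_funs K"
proof -
  obtain L where "L-lipschitz_on K f" using assms by (auto simp: lip_funs_def)
  from lip_funs_restrict[OF lipschitz_on_cmult_real[OF this]] show ?thesis .
qed

lemma equiv_lip_rel: "equiv (lip_funs K) (lip_rel K)"
proof (rule equivI)
  show "lip_rel K \<subseteq> lip_funs K \<times> lip_funs K" by (auto simp: lip_rel_def)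
  show "refl_on (lip_funs K) (lip_rel K)" by (auto simp: refl_on_def lip_rel_def)
  show "sym (lip_rel K)"
  proof (rule symI)
    fix f g assume "(f, g) \<in> lip_rel K"
    then obtain c where "f \<in> lip_funs K" "g \<in> lip_funs K" "\<forall>t\<in>K. f t - g t = c"
      by (auto simp: lip_rel_def)
    then have "\<forall>t\<in>K. g t - f t = - c" by (metis minus_diff_eq)
    then show "(g, f) \<in> lip_rel K" using \<open>f \<in> _\<close> \<open>g \<in> _\<close> by (auto simp: lip_rel_def)
  qed
  show "trans (lip_rel K)"
  proof (rule transI)
    fix f g h assume "(f, g) \<in> lip_rel K" "(g, h) \<in> lip_rel K"
    then obtain c d where *: "f \<in> lip_funs K" "h \<in> lip_funs K"
       "\<forall>t\<in>K. f t - g t = c" "\<forall>t\<in>K. g t - h t = d"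
      by (auto simp: lip_rel_def)
    have "\<forall>t\<in>K. f t - h t = c + d" using *(3,4) by fastforce
    then show "(f, h) \<in> lip_rel K" using * by (auto simp: lip_rel_def)
  qed
qed

lemma lip_relI:
  "\<lbrakk>f \<in> lip_funs K; g \<in> lip_funs K; \<And>t. t \<in> K \<Longrightarrow> f t - g t = c\<rbrakk> \<Longrightarrow> (f, g) \<in> lip_rel K"
  by (auto simp: lip_rel_def)

lemma Lip_add_class:
  assumes "f \<in> lip_funs K" "g \<in> lip_funs K"
  shows "vadd (Lip K) (lip_rel K `` {f}) (lip_rel K `` {g}) = lip_rel K `` {\<lambda>t\<in>K. f t + g t}"
proof -
  have "congruent2 (lip_rel K) (lip_rel K) (\<lambda>f g. lip_rel K `` {\<lambda>t\<in>K. f t + g t})"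
  proof (rule congruent2I')
    fix f f' g g' assume "(f, f') \<in> lip_rel K" "(g, g') \<in> lip_rel K"
    then obtain c d where *: "f \<in> lip_funs K" "f' \<in> lip_funs K" "g \<in> lip_funs K" "g' \<in> lip_funs K"
       "\<forall>t\<in>K. f t - f' t = c" "\<forall>t\<in>K. g t - g' t = d"
      by (auto simp: lip_rel_def)
    have "(\<lambda>t\<in>K. f t + g t, \<lambda>t\<in>K. f' t + g' t) \<in> lip_rel K"
      using * by (intro lip_relI[of _ _ _ "c + d"] lip_funs_add) fastforce+
    then show "lip_rel K `` {\<lambda>t\<in>K. f t + g t} = lip_rel K `` {\<lambda>t\<in>K. f' t + g' t}"
      by (rule equiv_class_eq[OF equiv_lip_rel])
  qed
  from UN_equiv_class2[OF equiv_lip_rel equiv_lip_rel this assms] show ?thesis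
    by (simp add: Lip_def)
qed

lemma Lip_scale_class:
  assumes "f \<in> lip_funs K"
  shows "vscale (Lip K) a (lip_rel K `` {f}) = lip_rel K `` {\<lambda>t\<in>K. a * f t}"
proof -
  have "congruent (lip_rel K) (\<lambda>f. lip_rel K `` {\<lambda>t\<in>K. a * f t})"
  proof (rule congruentI)
    fix f f' assume "(f, f') \<in> lip_rel K"
    then obtain c where *: "f \<in> lip_funs K" "f' \<in> lip_funs K" "\<forall>t\<in>K. f t - f' t = c"
      by (auto simp: lip_rel_def)
    have "(\<lambda>t\<in>K. a * f t, \<lambda>t\<in>K. a * f' t) \<in> lip_rel K"
      using * by (intro lip_relI[of _ _ _ "a * c"] lip_funs_scale)
        (auto simp: right_diff_distrib[symmetric])
    then show "lip_rel K `` {\<lambda>t\<in>K. a * f t} = lip_rel K `` {\<lambda>t\<in>K. a * f' t}"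
      by (rule equiv_class_eq[OF equiv_lip_rel])
  qed
  from UN_equiv_class[OF equiv_lip_rel this assms] show ?thesis
    by (simp add: Lip_def)
qed

lemma Lip_norm_class:
  assumes "f \<in> lip_funs K"
  shows "vnorm (Lip K) (lip_rel K `` {f}) = lip_seminorm K f"
proof -
  have "lip_seminorm K g \<in> {lip_seminorm K f}" if fg: "(f, g) \<in> lip_rel K" for g
  proof -
    obtain c where "\<forall>t\<in>K. f t - g t = c" using fg by (auto simp: lip_rel_def)
    then have "f t = g t + c" if "t \<in> K" for t using that by (simp add: algebra_simps)
    then have eq: "g s - g t = f s - f t" if "s \<in> K" "t \<in> K" for s t
      using that by simp
    have "{\<bar>g s - g t\<bar> / dist s t |s t. s \<in> K \<and> t \<in> K \<and> s \<noteq> t}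
             = {\<bar>f s - f t\<bar> / dist s t |s t. s \<in> K \<and> t \<in> K \<and> s \<noteq> t}"
      by (rule Collect_cong, rule iff_exI, rule iff_exI) (auto simp: eq)
    then show ?thesis by (simp add: lip_seminorm_def)
  qed
  moreover have "f \<in> lip_rel K `` {f}"
    using equiv_class_self[OF equiv_lip_rel assms] .
  ultimately have "lip_seminorm K ` (lip_rel K `` {f}) = {lip_seminorm K f}" by blast
  then show ?thesis by (simp add: Lip_def)
qed

lemma lip_seminorm_quot_le:
  assumes "f \<in> lip_funs K" "s \<in> K" "t \<in> K"
  shows "\<bar>f s - f t\<bar> \<le> lip_seminorm K f * dist s t"
proof (cases "s = t")
  case False
  obtain L where L: "L-lipschitz_on K f" using assms(1) by (auto simp: lip_funs_def)
  have "\<bar>f s - f t\<bar> / dist s t \<le> lip_seminorm K f"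
    unfolding lip_seminorm_def
  proof (rule cSup_upper)
    show "bdd_above {\<bar>f s - f t\<bar> / dist s t |s t. s \<in> K \<and> t \<in> K \<and> s \<noteq> t}"
    proof (rule bdd_aboveI[of _ L])
      fix x assume "x \<in> {\<bar>f s - f t\<bar> / dist s t |s t. s \<in> K \<and> t \<in> K \<and> s \<noteq> t}"
      then obtain s t where "s \<in> K" "t \<in> K" "s \<noteq> t" "x = \<bar>f s - f t\<bar> / dist s t" by auto
      then show "x \<le> L" using lipschitz_onD[OF L, of s t]
        by (simp add: dist_real_def divide_le_eq)
    qed
  qed (use assms False in auto)
  then show ?thesis using False by (simp add: divide_le_eq)
qed auto

lemma lip_seminorm_le:
  assumes "\<And>s t. s \<in> K \<Longrightarrow> t \<in> K \<Longrightarrow> \<bar>f s - f t\<bar> \<le> B * dist s t"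
    and "s0 \<in> K" "t0 \<in> K" "s0 \<noteq> t0"
  shows "lip_seminorm K f \<le> B"
  unfolding lip_seminorm_def
  by (rule cSup_least) (use assms in \<open>auto simp: divide_le_eq\<close>)

lemma lip_seminorm_nonneg:
  assumes "f \<in> lip_funs K" "s0 \<in> K" "t0 \<in> K" "s0 \<noteq> t0"
  shows "0 \<le> lip_seminorm K f"
proof -
  have "0 \<le> lip_seminorm K f * dist s0 t0"
    using lip_seminorm_quot_le[OF assms(1-3)] by linarith
  then show ?thesis using assms(4) by (simp add: zero_le_mult_iff)
qed

lemma lip_seminorm_add_le:
  assumes "f \<in> lip_funs K" "g \<in> lip_funs K" "s0 \<in> K" "t0 \<in> K" "s0 \<noteq> t0"
  shows "lip_seminorm K (\<lambda>t\<in>K. f t + g t) \<le> lip_seminorm K f + lip_seminorm K g"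
proof (rule lip_seminorm_le[OF _ assms(3-5)])
  fix s t assume "s \<in> K" "t \<in> K"
  then show "\<bar>(\<lambda>t\<in>K. f t + g t) s - (\<lambda>t\<in>K. f t + g t) t\<bar>
        \<le> (lip_seminorm K f + lip_seminorm K g) * dist s t"
    using lip_seminorm_quot_le[OF assms(1), of s t] lip_seminorm_quot_le[OF assms(2), of s t]
    by (simp add: distrib_right)
qed

lemma lip_seminorm_scale_le:
  assumes "f \<in> lip_funs K" "s0 \<in> K" "t0 \<in> K" "s0 \<noteq> t0"
  shows "lip_seminorm K (\<lambda>t\<in>K. a * f t) \<le> \<bar>a\<bar> * lip_seminorm K f"
proof (rule lip_seminorm_le[OF _ assms(2-4)])
  fix s t assume st: "s \<in> K" "t \<in> K"
  have "\<bar>a * f s - a * f t\<bar> = \<bar>a\<bar> * \<bar>f s - f t\<bar>"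
    by (simp add: abs_mult right_diff_distrib[symmetric])
  also have "\<dots> \<le> \<bar>a\<bar> * (lip_seminorm K f * dist s t)"
    by (rule mult_left_mono[OF lip_seminorm_quot_le[OF assms(1) st]]) simp
  finally show "\<bar>(\<lambda>t\<in>K. a * f t) s - (\<lambda>t\<in>K. a * f t) t\<bar> \<le> \<bar>a\<bar> * lip_seminorm K f * dist s t"
    using st by (simp add: mult.assoc)
qed

lemma lip_seminorm_scale:
  assumes "f \<in> lip_funs K" "s0 \<in> K" "t0 \<in> K" "s0 \<noteq> t0"
  shows "lip_seminorm K (\<lambda>t\<in>K. a * f t) = \<bar>a\<bar> * lip_seminorm K f"
proof (cases "a = 0")
  case True
  have "lip_seminorm K (\<lambda>t\<in>K. a * f t) \<le> 0"
    using lip_seminorm_scale_le[OF assms, of a] True by simp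
  moreover have "0 \<le> lip_seminorm K (\<lambda>t\<in>K. a * f t)"
    by (rule lip_seminorm_nonneg[OF lip_funs_scale[OF assms(1)] assms(2-4)])
  ultimately show ?thesis using True by simp
next
  case False
  have "(\<lambda>t\<in>K. inverse a * (\<lambda>t\<in>K. a * f t) t) = f"
    using False assms(1) by (auto simp: fun_eq_iff lip_funs_def extensional_def)
  with lip_seminorm_scale_le[OF lip_funs_scale[OF assms(1), of a] assms(2-4), of "inverse a"]
  have "lip_seminorm K f \<le> \<bar>inverse a\<bar> * lip_seminorm K (\<lambda>t\<in>K. a * f t)" by simp
  then have "\<bar>a\<bar> * lip_seminorm K f \<le> \<bar>a\<bar> * (\<bar>inverse a\<bar> * lip_seminorm K (\<lambda>t\<in>K. a * f t))"
    by (rule mult_left_mono) simp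
  then have "\<bar>a\<bar> * lip_seminorm K f \<le> lip_seminorm K (\<lambda>t\<in>K. a * f t)"
    using False by (simp add: mult.assoc[symmetric] abs_mult[symmetric])
  with lip_seminorm_scale_le[OF assms, of a] show ?thesis by simp
qed

lemma Lip_car_cases:
  assumes "A \<in> car (Lip K)"
  obtains f where "f \<in> lip_funs K" "A = lip_rel K `` {f}"
  using assms by (auto simp: Lip_def elim: quotientE)

lemma Lip_class_in_car: "f \<in> lip_funs K \<Longrightarrow> lip_rel K `` {f} \<in> car (Lip K)"
  by (simp add: Lip_def quotientI)

lemma Lip_diff_class:
  assumes "f \<in> lip_funs K" "g \<in> lip_funs K"
  shows "vdiff (Lip K) (lip_rel K `` {f}) (lip_rel K `` {g}) = lip_rel K `` {\<lambda>t\<in>K. f t - g t}"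
proof -
  have "(\<lambda>t\<in>K. f t + (\<lambda>t\<in>K. - 1 * g t) t) = (\<lambda>t\<in>K. f t - g t)" by auto
  then show ?thesis
    using assms by (simp only: vdiff_def Lip_scale_class Lip_add_class lip_funs_scale)
qed

lemma lip_funs_diff:
  assumes "f \<in> lip_funs K" "g \<in> lip_funs K"
  shows "(\<lambda>t\<in>K. f t - g t) \<in> lip_funs K"
proof -
  have "(\<lambda>t\<in>K. f t + (\<lambda>t\<in>K. - 1 * g t) t) = (\<lambda>t\<in>K. f t - g t)" by auto
  with lip_funs_add[OF assms(1) lip_funs_scale[OF assms(2), of "-1"]] show ?thesis by simp
qed

lemma Lip_vzero: "vzero (Lip K) = lip_rel K `` {\<lambda>t\<in>K. 0}"
  by (simp add: Lip_def)

lemma Lip_complete: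
  assumes K: "s0 \<in> K" "t0 \<in> K" "s0 \<noteq> t0"
    and car: "\<And>n. A n \<in> car (Lip K)"
    and cauchy: "\<And>e. e > 0 \<Longrightarrow> \<exists>N. \<forall>m\<ge>N. \<forall>n\<ge>N. vnorm (Lip K) (vdiff (Lip K) (A m) (A n)) < e"
  shows "\<exists>B\<in>car (Lip K). (\<lambda>n::nat. vnorm (Lip K) (vdiff (Lip K) (A n) B)) \<longlonglongrightarrow> 0"
proof -
  have "\<exists>f. f \<in> lip_funs K \<and> A n = lip_rel K `` {f}" for n
    by (rule Lip_car_cases[OF car[of n]]) blast
  then obtain f where f: "\<And>n. f n \<in> lip_funs K" "\<And>n. A n = lip_rel K `` {f n}"
    using choice[of "\<lambda>n f. f \<in> lip_funs K \<and> A n = lip_rel K `` {f}"] by blast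
  define p where "p m n = lip_seminorm K (\<lambda>t\<in>K. f m t - f n t)" for m n
  have norm_p: "vnorm (Lip K) (vdiff (Lip K) (A m) (A n)) = p m n" for m n
    by (simp add: f p_def Lip_diff_class Lip_norm_class lip_funs_diff)
  have C: "\<exists>N. \<forall>m\<ge>N. \<forall>n\<ge>N. p m n < e" if "e > 0" for e
    using cauchy[OF that] by (simp add: norm_p)
  have le: "\<bar>(f m s - f m t) - (f n s - f n t)\<bar> \<le> p m n * dist s t" if "s \<in> K" "t \<in> K" for m n s t
    using lip_seminorm_quot_le[OF lip_funs_diff[OF f(1)[of m] f(1)[of n]] that] that
    unfolding p_def by (simp add: algebra_simps)
  have conv: "convergent (\<lambda>n. f n t - f n s0)" if t: "t \<in> K" for t
  proof (cases "t = s0")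
    case False
    have "Cauchy (\<lambda>n. f n t - f n s0)"
    proof (rule metric_CauchyI)
      fix e :: real assume "e > 0"
      then have "e / dist t s0 > 0" using False by simp
      from C[OF this] obtain N where N: "\<forall>m\<ge>N. \<forall>n\<ge>N. p m n < e / dist t s0" by auto
      have "dist (f m t - f m s0) (f n t - f n s0) < e" if "m \<ge> N" "n \<ge> N" for m n
      proof -
        have "p m n * dist t s0 < e"
          using N that False by (simp add: less_divide_eq)
        then show ?thesis using le[OF t K(1), of m n] by (simp add: dist_real_def)
      qed
      then show "\<exists>N. \<forall>m\<ge>N. \<forall>n\<ge>N. dist (f m t - f m s0) (f n t - f n s0) < e" by blast
    qed
    then show ?thesis by (simp add: Cauchy_convergent_iff)
  qed (simp add: convergent_const)
  define g where "g = (\<lambda>t\<in>K. lim (\<lambda>n. f n t - f n s0))"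
  have g: "(\<lambda>n. f n t - f n s0) \<longlonglongrightarrow> g t" if "t \<in> K" for t
    using conv[OF that] that by (simp add: g_def convergent_LIMSEQ_iff)
  have gd: "(\<lambda>n. f n s - f n t) \<longlonglongrightarrow> g s - g t" if "s \<in> K" "t \<in> K" for s t
    using tendsto_diff[OF g[OF that(1)] g[OF that(2)]] by simp
  have close: "\<exists>N. \<forall>m\<ge>N. \<forall>s\<in>K. \<forall>t\<in>K. \<bar>(f m s - f m t) - (g s - g t)\<bar> \<le> e * dist s t"
    if e: "e > 0" for e
  proof -
    obtain N where N: "\<forall>m\<ge>N. \<forall>n\<ge>N. p m n < e" using C[OF e] by auto
    have "\<bar>(f m s - f m t) - (g s - g t)\<bar> \<le> e * dist s t" if "m \<ge> N" "s \<in> K" "t \<in> K" for m s t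
    proof (rule LIMSEQ_le_const2)
      show "(\<lambda>n. \<bar>(f m s - f m t) - (f n s - f n t)\<bar>) \<longlonglongrightarrow> \<bar>(f m s - f m t) - (g s - g t)\<bar>"
        by (intro tendsto_rabs tendsto_diff[OF tendsto_const] gd that)
      have "\<bar>(f m s - f m t) - (f n s - f n t)\<bar> \<le> e * dist s t" if "n \<ge> N" for n
      proof -
        have "p m n * dist s t \<le> e * dist s t"
          using N \<open>m \<ge> N\<close> that by (intro mult_right_mono) (auto intro: less_imp_le)
        then show ?thesis using le[OF \<open>s \<in> K\<close> \<open>t \<in> K\<close>, of m n] by linarith
      qed
      then show "\<exists>N. \<forall>n\<ge>N. \<bar>(f m s - f m t) - (f n s - f n t)\<bar> \<le> e * dist s t" by blast
    qed
    then show ?thesis by blast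
  qed
  have gin: "g \<in> lip_funs K"
  proof -
    obtain N where N: "\<forall>s\<in>K. \<forall>t\<in>K. \<bar>(f N s - f N t) - (g s - g t)\<bar> \<le> 1 * dist s t"
      using close[of 1] by auto
    have "\<bar>g s - g t\<bar> \<le> (1 + lip_seminorm K (f N)) * dist s t" if "s \<in> K" "t \<in> K" for s t
    proof -
      have "\<bar>(f N s - f N t) - (g s - g t)\<bar> \<le> dist s t" using N that by simp
      then show ?thesis using lip_seminorm_quot_le[OF f(1) that, of N] by (simp add: distrib_right)
    qed
    moreover have "0 \<le> lip_seminorm K (f N)" by (rule lip_seminorm_nonneg[OF f(1) K])
    ultimately have "(1 + lip_seminorm K (f N))-lipschitz_on K g"
      by (intro lipschitz_onI) (auto simp: dist_real_def)
    then show ?thesis unfolding lip_funs_def by (auto simp: g_def)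
  qed
  have "(\<lambda>n. vnorm (Lip K) (vdiff (Lip K) (A n) (lip_rel K `` {g}))) \<longlonglongrightarrow> 0"
  proof (rule LIMSEQ_I)
    fix e :: real assume "e > 0"
    then obtain N where N: "\<forall>m\<ge>N. \<forall>s\<in>K. \<forall>t\<in>K. \<bar>(f m s - f m t) - (g s - g t)\<bar> \<le> e / 2 * dist s t"
      using close[of "e / 2"] by auto
    have "norm (vnorm (Lip K) (vdiff (Lip K) (A n) (lip_rel K `` {g})) - 0) < e" if "n \<ge> N" for n
    proof -
      let ?h = "\<lambda>t\<in>K. f n t - g t"
      have h: "?h \<in> lip_funs K" by (rule lip_funs_diff[OF f(1) gin])
      have "lip_seminorm K ?h \<le> e / 2"
      proof (rule lip_seminorm_le[OF _ K])
        fix s t assume st: "s \<in> K" "t \<in> K"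
        have "\<bar>(f n s - f n t) - (g s - g t)\<bar> \<le> e / 2 * dist s t" using N that st by blast
        then show "\<bar>?h s - ?h t\<bar> \<le> e / 2 * dist s t" using st by (simp add: algebra_simps)
      qed
      moreover have "0 \<le> lip_seminorm K ?h" by (rule lip_seminorm_nonneg[OF h K])
      moreover have "vnorm (Lip K) (vdiff (Lip K) (A n) (lip_rel K `` {g})) = lip_seminorm K ?h"
        by (simp add: f gin h Lip_diff_class Lip_norm_class)
      ultimately show ?thesis using \<open>e > 0\<close> by simp
    qed
    then show "\<exists>N. \<forall>n\<ge>N. norm (vnorm (Lip K) (vdiff (Lip K) (A n) (lip_rel K `` {g})) - 0) < e"
      by blast
  qed
  then show ?thesis using Lip_class_in_car[OF gin] by blast
qed

theorem Lip_banach: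
  assumes K: "s0 \<in> K" "t0 \<in> K" "s0 \<noteq> t0"
  shows "banach_space_on (Lip K)"
proof
  note simps = Lip_add_class Lip_scale_class Lip_norm_class Lip_diff_class Lip_vzero
    lip_funs_zero lip_funs_add lip_funs_scale lip_funs_diff
  show "vzero (Lip K) \<in> car (Lip K)" by (simp add: simps Lip_class_in_car)
  fix A assume "A \<in> car (Lip K)"
  then obtain f where f: "f \<in> lip_funs K" "A = lip_rel K `` {f}" by (rule Lip_car_cases)
  have fK: "(\<lambda>t\<in>K. f t) = f"
    using f(1) by (simp add: lip_funs_def extensional_restrict)
  show "vscale (Lip K) a A \<in> car (Lip K)" for a
    by (simp add: f simps Lip_class_in_car)
  show "vadd (Lip K) A (vzero (Lip K)) = A"
    using f by (simp add: simps fK cong: restrict_cong)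
  show "vdiff (Lip K) A A = vzero (Lip K)"
    using f by (simp add: simps)
  show "vscale (Lip K) (a + b) A = vadd (Lip K) (vscale (Lip K) a A) (vscale (Lip K) b A)" for a b
    using f by (simp add: simps distrib_right cong: restrict_cong)
  show "vscale (Lip K) a (vscale (Lip K) b A) = vscale (Lip K) (a * b) A" for a b
    using f by (simp add: simps mult.assoc cong: restrict_cong)
  show "vscale (Lip K) 1 A = A"
    using f by (simp add: simps fK)
  show "0 \<le> vnorm (Lip K) A"
    using f lip_seminorm_nonneg[OF f(1) K] by (simp add: simps)
  show "vnorm (Lip K) (vscale (Lip K) a A) = \<bar>a\<bar> * vnorm (Lip K) A" for a
    using f lip_seminorm_scale[OF f(1) K] by (simp add: simps)
  show "vnorm (Lip K) A = 0 \<longleftrightarrow> A = vzero (Lip K)"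
  proof
    assume "vnorm (Lip K) A = 0"
    then have 0: "lip_seminorm K f = 0" using f by (simp add: simps)
    have "f t - (\<lambda>t\<in>K. 0) t = f s0" if "t \<in> K" for t
      using lip_seminorm_quot_le[OF f(1) that K(1)] that 0 by simp
    then have "(f, \<lambda>t\<in>K. 0) \<in> lip_rel K"
      by (intro lip_relI f(1) lip_funs_zero)
    then show "A = vzero (Lip K)"
      unfolding f Lip_vzero by (rule equiv_class_eq[OF equiv_lip_rel])
  next
    assume A: "A = vzero (Lip K)"
    have "lip_seminorm K (\<lambda>t\<in>K. 0) = 0"
      using lip_seminorm_scale[OF f(1) K, of 0] by simp
    then show "vnorm (Lip K) A = 0" by (simp add: A simps)
  qed
  fix B assume "B \<in> car (Lip K)"
  then obtain g where g: "g \<in> lip_funs K" "B = lip_rel K `` {g}" by (rule Lip_car_cases)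
  show "vadd (Lip K) A B \<in> car (Lip K)"
    using f g by (simp add: simps Lip_class_in_car)
  show "vadd (Lip K) A B = vadd (Lip K) B A"
    using f g by (simp add: simps add.commute)
  show "vscale (Lip K) a (vadd (Lip K) A B) = vadd (Lip K) (vscale (Lip K) a A) (vscale (Lip K) a B)" for a
    using f g by (simp add: simps distrib_left cong: restrict_cong)
  show "vnorm (Lip K) (vadd (Lip K) A B) \<le> vnorm (Lip K) A + vnorm (Lip K) B"
    using f g lip_seminorm_add_le[OF f(1) g(1) K] by (simp add: simps)
  fix C assume "C \<in> car (Lip K)"
  then obtain h where h: "h \<in> lip_funs K" "C = lip_rel K `` {h}" by (rule Lip_car_cases)
  show "vadd (Lip K) (vadd (Lip K) A B) C = vadd (Lip K) A (vadd (Lip K) B C)"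
    using f g h by (simp add: simps add.assoc cong: restrict_cong)
next
  fix A :: "nat \<Rightarrow> _"
  assume "\<And>n. A n \<in> car (Lip K)"
    and "\<And>e. e > 0 \<Longrightarrow> \<exists>N. \<forall>m\<ge>N. \<forall>n\<ge>N. vnorm (Lip K) (vdiff (Lip K) (A m) (A n)) < e"
  then show "\<exists>x\<in>car (Lip K). (\<lambda>n. vnorm (Lip K) (vdiff (Lip K) (A n) x)) \<longlonglongrightarrow> 0"
    by (rule Lip_complete[OF K])
qed

section \<open>Geometry of the norm of the ambient space\<close>

text \<open>Every point of the unit sphere has exactly one norm-one supporting functional.\<close>

definition smooth_space :: "'e::real_normed_vector itself \<Rightarrow> bool" where
  "smooth_space _ \<longleftrightarrow> (\<forall>x::'e. norm x = 1 \<longrightarrow>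
    (\<exists>!\<phi> :: 'e \<Rightarrow>\<^sub>L real. norm \<phi> = 1 \<and> blinfun_apply \<phi> x = 1))"

definition locally_uniformly_rotund :: "'e::real_normed_vector itself \<Rightarrow> bool" where
  "locally_uniformly_rotund _ \<longleftrightarrow> (\<forall>x::'e. norm x = 1 \<longrightarrow> (\<forall>\<eta>>0. \<exists>\<delta>>0. \<forall>y.
    norm y \<le> 1 \<and> norm ((1/2) *\<^sub>R (x + y)) \<ge> 1 - \<delta> \<longrightarrow> norm (x - y) \<le> \<eta>))"

end

theory Submission
  imports Defs
begin

text \<open>
  A rank-one operator on \<open>Lip K\<close> is \<open>f \<mapsto> \<Phi> f \<cdot> g\<close> with \<open>\<parallel>g\<parallel> = 1\<close> and \<open>\<Phi>\<close> a bounded functional, so the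
  Daugavet property says that \<open>sup \<parallel>f + \<Phi> f \<cdot> g\<parallel> = 1 + sup \<bar>\<Phi> f\<bar>\<close> over the unit ball
  (\<open>daugavet_property_Lip_iff\<close>). After this translation both implications are about real functions
  on \<open>K\<close>.

  If \<open>K\<close> is convex, the slope of \<open>g\<close> is almost \<open>1\<close> on many short pieces of one segment. Given an
  \<open>f\<close> in the unit ball that almost attains \<open>\<parallel>\<Phi>\<parallel>\<close>, one can give \<open>f\<close> slope exactly \<open>1\<close> on any one of these
  pieces, changing it only in a small ball and hardly increasing its norm. The changes belonging to
  different pieces have disjoint supports, hence their signed sums are bounded in norm, and so \<open>\<Phi>\<close>
  must be almost blind to one of them (\<open>sum_abs_functional_disjoint_supports\<close>). The function \<open>h\<close>
  modified there keeps \<open>\<Phi> h\<close> almost maximal, and \<open>h + \<Phi> h \<cdot> g\<close> has slope almost \<open>1 + \<parallel>\<Phi>\<parallel>\<close>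
  on that piece (\<open>convex_perturbation\<close>, \<open>convex_imp_daugavet_property_Lip\<close>).

  Conversely, if \<open>Lip K\<close> has the Daugavet property and \<open>K\<close> is compact, then Lipschitz constants can
  be read off at arbitrarily small scales: a Lipschitz function that is \<open>1\<close>-Lipschitz for pairs at distance
  less than some fixed \<open>\<epsilon>\<close> is \<open>1\<close>-Lipschitz (\<open>daugavet_property_Lip_imp_local\<close>). Otherwise its
  normalization \<open>g\<close> would have slope almost \<open>1\<close> only on pairs at distance at least \<open>\<epsilon>\<close>; these
  cluster around finitely many pairs, and minus the average of the slopes over these pairs, times
  \<open>g\<close>, is a rank-one operator violating the Daugavet equation. Locality is then applied to the
  infimum of the lengths of \<open>\<epsilon>\<close>-chains in \<open>K\<close> from a given point \<open>a\<close>, truncated at a constant. Its slopes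
  at scale \<open>\<epsilon>\<close> are at most \<open>1\<close> by construction, so every \<open>b \<in> K\<close> is joined to \<open>a\<close> inside \<open>K\<close> by
  \<open>\<epsilon>\<close>-chains hardly longer than \<open>dist a b\<close>. Letting \<open>\<epsilon> \<longrightarrow> 0\<close>, compactness yields a metric
  midpoint of \<open>a\<close> and \<open>b\<close> in \<open>K\<close> (\<open>daugavet_property_Lip_imp_midpoint\<close>). By rotundity it is the
  midpoint of the segment, and a closed midpoint-convex set is convex.
\<close>

section \<open>Rank-one operators as functionals on Lipschitz functions\<close>

text \<open>
  Functionals on \<open>Lip K\<close> are represented on the functions themselves. The bound by the seminorm
  forces the same value on functions that differ by a constant.
\<close>

definition lip_functional :: "'a::metric_space set \<Rightarrow> (('a \<Rightarrow> real) \<Rightarrow> real) \<Rightarrow> bool" where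
  "lip_functional K \<Phi> \<longleftrightarrow>
    (\<forall>f\<in>lip_funs K. \<forall>g\<in>lip_funs K. \<Phi> (\<lambda>t\<in>K. f t + g t) = \<Phi> f + \<Phi> g) \<and>
    (\<forall>a. \<forall>f\<in>lip_funs K. \<Phi> (\<lambda>t\<in>K. a * f t) = a * \<Phi> f) \<and>
    (\<exists>B. \<forall>f\<in>lip_funs K. \<bar>\<Phi> f\<bar> \<le> B * lip_seminorm K f)"

lemma lip_functionalD:
  assumes "lip_functional K \<Phi>" "f \<in> lip_funs K"
  shows "g \<in> lip_funs K \<Longrightarrow> \<Phi> (\<lambda>t\<in>K. f t + g t) = \<Phi> f + \<Phi> g"
    and "\<Phi> (\<lambda>t\<in>K. a * f t) = a * \<Phi> f"
  using assms unfolding lip_functional_def by auto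

lemma lip_functional_diff:
  assumes "lip_functional K \<Phi>" "f \<in> lip_funs K" "g \<in> lip_funs K"
  shows "\<Phi> (\<lambda>t\<in>K. f t - g t) = \<Phi> f - \<Phi> g"
proof -
  have "(\<lambda>t\<in>K. f t - g t) = (\<lambda>t\<in>K. f t + (\<lambda>t\<in>K. - 1 * g t) t)" by auto
  then show ?thesis
    using lip_functionalD(1)[OF assms(1,2), of "\<lambda>t\<in>K. - 1 * g t"]
      lip_functionalD(2)[OF assms(1,3), of "-1"] lip_funs_scale[OF assms(3), of "-1"] by simp
qed

lemma lip_functional_bound:
  assumes "lip_functional K \<Phi>" "s0 \<in> K" "t0 \<in> K" "s0 \<noteq> t0"
  obtains B where "B \<ge> 0" "\<And>f. f \<in> lip_funs K \<Longrightarrow> \<bar>\<Phi> f\<bar> \<le> B * lip_seminorm K f"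
proof -
  obtain B where B: "\<forall>f\<in>lip_funs K. \<bar>\<Phi> f\<bar> \<le> B * lip_seminorm K f"
    using assms(1) unfolding lip_functional_def by auto
  have "\<bar>\<Phi> f\<bar> \<le> \<bar>B\<bar> * lip_seminorm K f" if "f \<in> lip_funs K" for f
  proof -
    have "B * lip_seminorm K f \<le> \<bar>B\<bar> * lip_seminorm K f"
      by (intro mult_right_mono lip_seminorm_nonneg[OF that assms(2-4)]) auto
    then show ?thesis using B that by fastforce
  qed
  then show ?thesis using that[of "\<bar>B\<bar>"] by simp
qed

lemma lip_class_eq_iff:
  assumes "f \<in> lip_funs K" "g \<in> lip_funs K"
  shows "lip_rel K `` {f} = lip_rel K `` {g} \<longleftrightarrow> (\<exists>c. \<forall>t\<in>K. f t - g t = c)"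
  using eq_equiv_class_iff[OF equiv_lip_rel assms] assms by (simp add: lip_rel_def)

lemma lip_funs_of_bound:
  assumes "f \<in> extensional K" "\<And>s t. s \<in> K \<Longrightarrow> t \<in> K \<Longrightarrow> \<bar>f s - f t\<bar> \<le> L * dist s t"
  shows "f \<in> lip_funs K"
proof -
  have "\<bar>L\<bar>-lipschitz_on K f"
  proof (rule lipschitz_onI)
    fix s t assume "s \<in> K" "t \<in> K"
    have "L * dist s t \<le> \<bar>L\<bar> * dist s t" by (intro mult_right_mono) auto
    with assms(2)[OF \<open>s \<in> K\<close> \<open>t \<in> K\<close>] show "dist (f s) (f t) \<le> \<bar>L\<bar> * dist s t"
      by (simp add: dist_real_def)
  qed simp
  then show ?thesis using assms(1) by (auto simp: lip_funs_def)
qed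

text \<open>
  For an operator that is given on representatives, the supremum over classes in the unit ball
  becomes one over functions. It is applied to \<open>T\<close> and to \<open>Id + T\<close>.
\<close>
lemma op_norm_Lip:
  assumes "\<And>f. f \<in> lip_funs K \<Longrightarrow> H f \<in> lip_funs K"
    and "\<And>f. f \<in> lip_funs K \<Longrightarrow> T (lip_rel K `` {f}) = lip_rel K `` {H f}"
  shows "op_norm (Lip K) T =
    (SUP f\<in>{f \<in> lip_funs K. lip_seminorm K f \<le> 1}. lip_seminorm K (H f))"
proof -
  have "(\<lambda>x. vnorm (Lip K) (T x)) ` {x \<in> car (Lip K). vnorm (Lip K) x \<le> 1}
      = (\<lambda>f. lip_seminorm K (H f)) ` {f \<in> lip_funs K. lip_seminorm K f \<le> 1}" (is "?L = ?R")
  proof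
    show "?L \<subseteq> ?R"
    proof
      fix r assume "r \<in> ?L"
      then obtain A where A: "A \<in> car (Lip K)" "vnorm (Lip K) A \<le> 1" "r = vnorm (Lip K) (T A)"
        by auto
      from A(1) obtain f where f: "f \<in> lip_funs K" "A = lip_rel K `` {f}" by (rule Lip_car_cases)
      with A assms have "lip_seminorm K f \<le> 1" "r = lip_seminorm K (H f)"
        by (auto simp: Lip_norm_class)
      with f show "r \<in> ?R" by blast
    qed
    show "?R \<subseteq> ?L"
    proof
      fix r assume "r \<in> ?R"
      then obtain f where f: "f \<in> lip_funs K" "lip_seminorm K f \<le> 1" "r = lip_seminorm K (H f)"
        by auto
      then have "r = vnorm (Lip K) (T (lip_rel K `` {f}))" "vnorm (Lip K) (lip_rel K `` {f}) \<le> 1"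
        using assms by (auto simp: Lip_norm_class)
      with f(1) show "r \<in> ?L" by (auto intro!: image_eqI Lip_class_in_car)
    qed
  qed
  then show ?thesis by (simp add: op_norm_def)
qed

text \<open>
  The range of \<open>T\<close> is the line through a class \<open>y\<close>, which is normalized to \<open>g\<close>. The coefficient
  \<open>\<Phi> f\<close> of \<open>T f\<close> along \<open>g\<close> is unique because \<open>g\<close> is not constant, and this uniqueness transfers
  linearity from \<open>T\<close> to \<open>\<Phi>\<close>.
\<close>
lemma rank_one_imp_functional:
  assumes K: "s0 \<in> K" "t0 \<in> K" "s0 \<noteq> t0"
    and T: "bounded_op (Lip K) T" "rank_one (Lip K) T"
  obtains g \<Phi> where "g \<in> lip_funs K" "lip_seminorm K g = 1" "lip_functional K \<Phi>"
    "\<exists>f\<in>lip_funs K. \<Phi> f \<noteq> 0"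
    "\<And>f. f \<in> lip_funs K \<Longrightarrow> T (lip_rel K `` {f}) = lip_rel K `` {\<lambda>t\<in>K. \<Phi> f * g t}"
proof -
  interpret banach_space_on "Lip K" by (rule Lip_banach[OF K])
  obtain Y where Y: "Y \<in> car (Lip K)" "Y \<noteq> vzero (Lip K)"
    "T ` car (Lip K) = {vscale (Lip K) a Y |a. True}"
    using T(2) unfolding rank_one_def by (elim bexE conjE) (rule that)
  obtain y where y: "y \<in> lip_funs K" "Y = lip_rel K `` {y}" using Y(1) by (rule Lip_car_cases)
  define l where "l = lip_seminorm K y"
  have "vnorm (Lip K) Y = l" unfolding y(2) l_def by (rule Lip_norm_class[OF y(1)])
  then have l: "l > 0"
    using norm_eq_zero[OF Y(1)] norm_nonneg[OF Y(1)] Y(2) by simp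
  define g where "g = (\<lambda>t\<in>K. (1/l) * y t)"
  have g: "g \<in> lip_funs K" unfolding g_def by (rule lip_funs_scale[OF y(1)])
  have g1: "lip_seminorm K g = 1"
    unfolding g_def using lip_seminorm_scale[OF y(1) K, of "1/l"] l by (simp add: l_def)
  let ?c = "\<lambda>f. lip_rel K `` {f}"
  have ex: "\<exists>a. T (?c f) = ?c (\<lambda>t\<in>K. a * g t)" if f: "f \<in> lip_funs K" for f
  proof -
    have "T (?c f) \<in> {vscale (Lip K) a Y |a. True}"
      unfolding Y(3)[symmetric] by (rule imageI[OF Lip_class_in_car[OF f]])
    then obtain a where "T (?c f) = ?c (\<lambda>t\<in>K. a * y t)"
      by (auto simp: y Lip_scale_class)
    moreover have "(\<lambda>t\<in>K. a * y t) = (\<lambda>t\<in>K. (a * l) * g t)"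
      using l by (auto simp: g_def)
    ultimately have "T (?c f) = ?c (\<lambda>t\<in>K. (a * l) * g t)" by (simp only:)
    then show ?thesis by (rule exI)
  qed
  define \<Phi> where "\<Phi> f = (SOME a. T (?c f) = ?c (\<lambda>t\<in>K. a * g t))" for f
  have \<Phi>: "T (?c f) = ?c (\<lambda>t\<in>K. \<Phi> f * g t)" if "f \<in> lip_funs K" for f
    unfolding \<Phi>_def by (rule someI_ex[OF ex[OF that]])
  have "\<exists>s\<in>K. \<exists>t\<in>K. g s \<noteq> g t"
  proof (rule ccontr)
    assume no: "\<not> ?thesis"
    have "\<bar>g s - g t\<bar> \<le> 0 * dist s t" if "s \<in> K" "t \<in> K" for s t
    proof -
      have "g s = g t" using no that by blast
      then show ?thesis by simp
    qed
    then have "lip_seminorm K g \<le> 0" by (rule lip_seminorm_le[OF _ K])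
    then show False using g1 by simp
  qed
  then obtain s t where st: "s \<in> K" "t \<in> K" "g s \<noteq> g t" by blast
  have uniq: "a = b" if eq: "?c (\<lambda>t\<in>K. a * g t) = ?c (\<lambda>t\<in>K. b * g t)" for a b
  proof -
    have "\<exists>c. \<forall>t\<in>K. (\<lambda>t\<in>K. a * g t) t - (\<lambda>t\<in>K. b * g t) t = c"
      by (rule lip_class_eq_iff[THEN iffD1, OF lip_funs_scale[OF g] lip_funs_scale[OF g] eq])
    then obtain c where "\<forall>t\<in>K. (\<lambda>t\<in>K. a * g t) t - (\<lambda>t\<in>K. b * g t) t = c" ..
    from bspec[OF this st(1)] bspec[OF this st(2)]
    have "(a - b) * (g s - g t) = 0" using st(1,2) by (simp add: algebra_simps)
    then show ?thesis using st(3) by simp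
  qed
  note lin = T(1)[unfolded bounded_op_def linear_op_def]
  have "lip_functional K \<Phi>"
    unfolding lip_functional_def
  proof (intro conjI ballI allI)
    fix f f' assume f: "f \<in> lip_funs K" "f' \<in> lip_funs K"
    have "T (vadd (Lip K) (?c f) (?c f')) = vadd (Lip K) (T (?c f)) (T (?c f'))"
      using lin f by (simp add: Lip_class_in_car)
    then have "?c (\<lambda>t\<in>K. \<Phi> (\<lambda>t\<in>K. f t + f' t) * g t)
        = ?c (\<lambda>t\<in>K. (\<lambda>t\<in>K. \<Phi> f * g t) t + (\<lambda>t\<in>K. \<Phi> f' * g t) t)"
      using f by (simp only: Lip_add_class \<Phi> lip_funs_add lip_funs_scale g)
    moreover have "(\<lambda>t\<in>K. (\<lambda>t\<in>K. \<Phi> f * g t) t + (\<lambda>t\<in>K. \<Phi> f' * g t) t) = (\<lambda>t\<in>K. (\<Phi> f + \<Phi> f') * g t)"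
      by (auto simp: algebra_simps)
    ultimately show "\<Phi> (\<lambda>t\<in>K. f t + f' t) = \<Phi> f + \<Phi> f'"
      by (intro uniq) (simp only:)
  next
    fix a f assume f: "f \<in> lip_funs K"
    have "T (vscale (Lip K) a (?c f)) = vscale (Lip K) a (T (?c f))"
      using lin f by (simp add: Lip_class_in_car)
    then have "?c (\<lambda>t\<in>K. \<Phi> (\<lambda>t\<in>K. a * f t) * g t) = ?c (\<lambda>t\<in>K. a * (\<lambda>t\<in>K. \<Phi> f * g t) t)"
      using f by (simp only: Lip_scale_class \<Phi> lip_funs_scale g)
    moreover have "(\<lambda>t\<in>K. a * (\<lambda>t\<in>K. \<Phi> f * g t) t) = (\<lambda>t\<in>K. (a * \<Phi> f) * g t)"
      by auto
    ultimately show "\<Phi> (\<lambda>t\<in>K. a * f t) = a * \<Phi> f"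
      by (intro uniq) (simp only:)
  next
    obtain B where B: "\<forall>x\<in>car (Lip K). vnorm (Lip K) (T x) \<le> B * vnorm (Lip K) x"
      using T(1) by (auto simp: bounded_op_def)
    have "\<bar>\<Phi> f\<bar> \<le> B * lip_seminorm K f" if f: "f \<in> lip_funs K" for f
      using B[rule_format, OF Lip_class_in_car[OF f]] f lip_seminorm_scale[OF g K, of "\<Phi> f"] g1
      by (simp add: \<Phi> Lip_norm_class lip_funs_scale g)
    then show "\<exists>B. \<forall>f\<in>lip_funs K. \<bar>\<Phi> f\<bar> \<le> B * lip_seminorm K f" by blast
  qed
  moreover have "\<exists>f\<in>lip_funs K. \<Phi> f \<noteq> 0"
  proof (rule ccontr)
    assume no: "\<not> ?thesis"
    have "vscale (Lip K) 1 Y \<in> T ` car (Lip K)" unfolding Y(3) by blast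
    then have "Y \<in> T ` car (Lip K)" by (simp only: scale_one[OF Y(1)])
    then obtain A where A: "A \<in> car (Lip K)" "Y = T A" by auto
    from A(1) obtain f where f: "f \<in> lip_funs K" "A = ?c f" by (rule Lip_car_cases)
    have "\<Phi> f = 0" using no f(1) by blast
    then have "Y = ?c (\<lambda>t\<in>K. 0)" unfolding A(2) f(2) \<Phi>[OF f(1)] by simp
    then show False using Y(2) by (simp add: Lip_vzero)
  qed
  ultimately show ?thesis by (rule that[OF g g1, of \<Phi>, OF _ _ \<Phi>])
qed

text \<open>
  The converse: the value of \<open>\<Phi>\<close> on an arbitrary representative of a class defines the operator.
  It does not depend on the representative, since the difference of two has seminorm \<open>0\<close>.
\<close>
lemma functional_imp_rank_one:
  assumes K: "s0 \<in> K" "t0 \<in> K" "s0 \<noteq> t0"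
    and g: "g \<in> lip_funs K" "lip_seminorm K g = 1"
    and F: "lip_functional K \<Phi>" and f0: "f0 \<in> lip_funs K" "\<Phi> f0 \<noteq> 0"
  obtains T where "bounded_op (Lip K) T" "rank_one (Lip K) T"
    "\<And>f. f \<in> lip_funs K \<Longrightarrow> T (lip_rel K `` {f}) = lip_rel K `` {\<lambda>t\<in>K. \<Phi> f * g t}"
proof -
  interpret banach_space_on "Lip K" by (rule Lip_banach[OF K])
  let ?c = "\<lambda>f. lip_rel K `` {f}"
  obtain B where B: "B \<ge> 0" "\<And>f. f \<in> lip_funs K \<Longrightarrow> \<bar>\<Phi> f\<bar> \<le> B * lip_seminorm K f"
    using lip_functional_bound[OF F K] by blast
  define T where "T A = ?c (\<lambda>t\<in>K. \<Phi> (SOME f. f \<in> A) * g t)" for A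
  have T: "T (?c f) = ?c (\<lambda>t\<in>K. \<Phi> f * g t)" if f: "f \<in> lip_funs K" for f
  proof -
    have "(SOME f'. f' \<in> ?c f) \<in> ?c f"
      by (rule someI[of _ f]) (rule equiv_class_self[OF equiv_lip_rel f])
    then obtain f' where f': "f' = (SOME f'. f' \<in> ?c f)" "f' \<in> lip_funs K" "(f, f') \<in> lip_rel K"
      by (auto simp: lip_rel_def)
    have "\<exists>c. \<forall>t\<in>K. f t - f' t = c" using f'(3) by (auto simp: lip_rel_def)
    then obtain c where c: "\<forall>t\<in>K. f t - f' t = c" ..
    have "lip_seminorm K (\<lambda>t\<in>K. f t - f' t) \<le> 0"
      by (rule lip_seminorm_le[OF _ K]) (simp add: c)
    then have "\<bar>\<Phi> (\<lambda>t\<in>K. f t - f' t)\<bar> \<le> 0"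
      using B(2)[OF lip_funs_diff[OF f f'(2)]] B(1) by (meson mult_nonneg_nonpos order_trans)
    then have "\<Phi> f' = \<Phi> f" using lip_functional_diff[OF F f f'(2)] by simp
    then show ?thesis unfolding T_def f'(1)[symmetric] by simp
  qed
  have Tin: "T (?c f) \<in> car (Lip K)" if "f \<in> lip_funs K" for f
    using T[OF that] Lip_class_in_car[OF lip_funs_scale[OF g(1)]] by simp
  have "linear_op (Lip K) T"
    unfolding linear_op_def
  proof (intro conjI ballI allI)
    show "T \<in> car (Lip K) \<rightarrow> car (Lip K)" by (auto elim!: Lip_car_cases intro: Tin)
  next
    fix A A' assume "A \<in> car (Lip K)" "A' \<in> car (Lip K)"
    obtain f where f: "f \<in> lip_funs K" "A = ?c f"
      using \<open>A \<in> car (Lip K)\<close> by (rule Lip_car_cases)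
    obtain f' where f': "f' \<in> lip_funs K" "A' = ?c f'"
      using \<open>A' \<in> car (Lip K)\<close> by (rule Lip_car_cases)
    have "(\<lambda>t\<in>K. (\<lambda>t\<in>K. \<Phi> f * g t) t + (\<lambda>t\<in>K. \<Phi> f' * g t) t) = (\<lambda>t\<in>K. (\<Phi> f + \<Phi> f') * g t)"
      by (auto simp: algebra_simps)
    then show "T (vadd (Lip K) A A') = vadd (Lip K) (T A) (T A')"
      using f f' g by (simp only: Lip_add_class T lip_funs_add lip_funs_scale lip_functionalD[OF F])
  next
    fix a A assume "A \<in> car (Lip K)"
    then obtain f where f: "f \<in> lip_funs K" "A = ?c f" by (rule Lip_car_cases)
    have "(\<lambda>t\<in>K. a * (\<lambda>t\<in>K. \<Phi> f * g t) t) = (\<lambda>t\<in>K. (a * \<Phi> f) * g t)" by auto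
    then show "T (vscale (Lip K) a A) = vscale (Lip K) a (T A)"
      using f g by (simp only: Lip_scale_class T lip_funs_scale lip_functionalD[OF F])
  qed
  moreover have "\<forall>A\<in>car (Lip K). vnorm (Lip K) (T A) \<le> B * vnorm (Lip K) A"
  proof
    fix A assume "A \<in> car (Lip K)"
    then obtain f where f: "f \<in> lip_funs K" "A = ?c f" by (rule Lip_car_cases)
    then show "vnorm (Lip K) (T A) \<le> B * vnorm (Lip K) A"
      using B(2)[OF f(1)] lip_seminorm_scale[OF g(1) K, of "\<Phi> f"] g
      by (simp add: T Lip_norm_class lip_funs_scale)
  qed
  ultimately have bT: "bounded_op (Lip K) T" by (auto simp: bounded_op_def)
  have "rank_one (Lip K) T"
    unfolding rank_one_def
  proof (intro bexI conjI)
    show gc: "?c g \<in> car (Lip K)" by (rule Lip_class_in_car[OF g(1)])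
    show "?c g \<noteq> vzero (Lip K)"
      using norm_eq_zero[OF gc] g by (simp add: Lip_norm_class)
    show "T ` car (Lip K) = {vscale (Lip K) a (?c g) |a. True}"
    proof
      show "T ` car (Lip K) \<subseteq> {vscale (Lip K) a (?c g) |a. True}"
        using g(1) by (auto elim!: Lip_car_cases simp: T Lip_scale_class)
      show "{vscale (Lip K) a (?c g) |a. True} \<subseteq> T ` car (Lip K)"
      proof clarify
        fix a
        let ?f = "\<lambda>t\<in>K. (a / \<Phi> f0) * f0 t"
        have "T (?c ?f) = vscale (Lip K) a (?c g)"
          using T[OF lip_funs_scale[OF f0(1)], of "a / \<Phi> f0"]
            lip_functionalD(2)[OF F f0(1), of "a / \<Phi> f0"] f0(2)
          by (simp add: Lip_scale_class g(1))
        then show "vscale (Lip K) a (?c g) \<in> T ` car (Lip K)"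
          by (rule image_eqI[OF sym]) (rule Lip_class_in_car[OF lip_funs_scale[OF f0(1)]])
      qed
    qed
  qed
  from that[OF bT this T] show ?thesis .
qed

lemma daugavet_property_Lip_iff:
  assumes K: "s0 \<in> K" "t0 \<in> K" "s0 \<noteq> t0"
  defines "U \<equiv> {f \<in> lip_funs K. lip_seminorm K f \<le> 1}"
  shows "daugavet_property (Lip K) \<longleftrightarrow>
    (\<forall>g \<Phi>. g \<in> lip_funs K \<and> lip_seminorm K g = 1 \<and> lip_functional K \<Phi> \<and>
        (\<exists>f\<in>lip_funs K. \<Phi> f \<noteq> 0) \<longrightarrow>
      (SUP f\<in>U. lip_seminorm K (\<lambda>t\<in>K. f t + \<Phi> f * g t)) = 1 + (SUP f\<in>U. \<bar>\<Phi> f\<bar>))"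
proof -
  have norms: "op_norm (Lip K) T = (SUP f\<in>U. \<bar>\<Phi> f\<bar>)"
      "op_norm (Lip K) (\<lambda>x. vadd (Lip K) x (T x)) =
         (SUP f\<in>U. lip_seminorm K (\<lambda>t\<in>K. f t + \<Phi> f * g t))"
    if g: "g \<in> lip_funs K" "lip_seminorm K g = 1"
      and T: "\<And>f. f \<in> lip_funs K \<Longrightarrow> T (lip_rel K `` {f}) = lip_rel K `` {\<lambda>t\<in>K. \<Phi> f * g t}"
    for g \<Phi> T
  proof -
    show "op_norm (Lip K) T = (SUP f\<in>U. \<bar>\<Phi> f\<bar>)"
      using op_norm_Lip[of K "\<lambda>f. \<lambda>t\<in>K. \<Phi> f * g t" T] T lip_funs_scale[OF g(1)]
        lip_seminorm_scale[OF g(1) K] g(2) by (simp add: U_def)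
    have "(\<lambda>t\<in>K. f t + (\<lambda>t\<in>K. \<Phi> f * g t) t) = (\<lambda>t\<in>K. f t + \<Phi> f * g t)" for f by auto
    then have "(\<lambda>t\<in>K. f t + \<Phi> f * g t) \<in> lip_funs K \<and>
        vadd (Lip K) (lip_rel K `` {f}) (T (lip_rel K `` {f})) = lip_rel K `` {\<lambda>t\<in>K. f t + \<Phi> f * g t}"
      if "f \<in> lip_funs K" for f
      using that T lip_funs_add[OF that lip_funs_scale[OF g(1), of "\<Phi> f"]]
        Lip_add_class[OF that lip_funs_scale[OF g(1), of "\<Phi> f"]] by simp
    then show "op_norm (Lip K) (\<lambda>x. vadd (Lip K) x (T x)) =
         (SUP f\<in>U. lip_seminorm K (\<lambda>t\<in>K. f t + \<Phi> f * g t))"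
      unfolding U_def by (intro op_norm_Lip) auto
  qed
  show ?thesis
  proof (intro iffI allI impI)
    fix g \<Phi> assume D: "daugavet_property (Lip K)"
      and "g \<in> lip_funs K \<and> lip_seminorm K g = 1 \<and> lip_functional K \<Phi> \<and> (\<exists>f\<in>lip_funs K. \<Phi> f \<noteq> 0)"
    then obtain f0 where g: "g \<in> lip_funs K" "lip_seminorm K g = 1" and F: "lip_functional K \<Phi>"
      and f0: "f0 \<in> lip_funs K" "\<Phi> f0 \<noteq> 0" by auto
    obtain T where T: "bounded_op (Lip K) T" "rank_one (Lip K) T"
      "\<And>f. f \<in> lip_funs K \<Longrightarrow> T (lip_rel K `` {f}) = lip_rel K `` {\<lambda>t\<in>K. \<Phi> f * g t}"
      by (rule functional_imp_rank_one[OF K g F f0]) (rule that)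
    then have "op_norm (Lip K) (\<lambda>x. vadd (Lip K) x (T x)) = 1 + op_norm (Lip K) T"
      using D by (auto simp: daugavet_property_def)
    then show "(SUP f\<in>U. lip_seminorm K (\<lambda>t\<in>K. f t + \<Phi> f * g t)) = 1 + (SUP f\<in>U. \<bar>\<Phi> f\<bar>)"
      by (simp only: norms[OF g, of T \<Phi>, OF T(3)])
  next
    assume R: "\<forall>g \<Phi>. g \<in> lip_funs K \<and> lip_seminorm K g = 1 \<and> lip_functional K \<Phi> \<and>
        (\<exists>f\<in>lip_funs K. \<Phi> f \<noteq> 0) \<longrightarrow>
      (SUP f\<in>U. lip_seminorm K (\<lambda>t\<in>K. f t + \<Phi> f * g t)) = 1 + (SUP f\<in>U. \<bar>\<Phi> f\<bar>)"
    show "daugavet_property (Lip K)"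
      unfolding daugavet_property_def
    proof (intro allI impI)
      fix T assume "bounded_op (Lip K) T \<and> rank_one (Lip K) T"
      then have T1: "bounded_op (Lip K) T" "rank_one (Lip K) T" by auto
      obtain g \<Phi> where g: "g \<in> lip_funs K" "lip_seminorm K g = 1" and
        F: "lip_functional K \<Phi>" "\<exists>f\<in>lip_funs K. \<Phi> f \<noteq> 0"
        and T: "\<And>f. f \<in> lip_funs K \<Longrightarrow> T (lip_rel K `` {f}) = lip_rel K `` {\<lambda>t\<in>K. \<Phi> f * g t}"
        by (rule rank_one_imp_functional[OF K T1]) (rule that)
      have "(SUP f\<in>U. lip_seminorm K (\<lambda>t\<in>K. f t + \<Phi> f * g t)) = 1 + (SUP f\<in>U. \<bar>\<Phi> f\<bar>)"
        by (intro R[rule_format] conjI g F)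
      then show "op_norm (Lip K) (\<lambda>x. vadd (Lip K) x (T x)) = 1 + op_norm (Lip K) T"
        by (simp only: norms[OF g, of T \<Phi>, OF T])
    qed
  qed
qed

section \<open>Functionals on functions with disjoint supports\<close>

lemma lip_functional_sum:
  assumes F: "lip_functional K \<Phi>" and "finite I" "\<And>i. i \<in> I \<Longrightarrow> u i \<in> lip_funs K"
  shows "(\<lambda>t\<in>K. \<Sum>i\<in>I. c i * u i t) \<in> lip_funs K \<and>
    \<Phi> (\<lambda>t\<in>K. \<Sum>i\<in>I. c i * u i t) = (\<Sum>i\<in>I. c i * \<Phi> (u i))"
  using assms(2,3)
proof (induction I)
  case empty
  have "\<Phi> (\<lambda>t\<in>K. 0) = 0"
    using lip_functionalD(2)[OF F lip_funs_zero, of 0] by (simp only: mult_zero_left)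
  then show ?case by (simp only: sum.empty lip_funs_zero simp_thms)
next
  case (insert i I)
  let ?v = "\<lambda>t\<in>K. \<Sum>i\<in>I. c i * u i t"
  have "(\<lambda>t\<in>K. \<Sum>i\<in>insert i I. c i * u i t) = (\<lambda>t\<in>K. (\<lambda>t\<in>K. c i * u i t) t + ?v t)"
    using insert.hyps by auto
  moreover have "(\<lambda>t\<in>K. c i * u i t) \<in> lip_funs K" "\<Phi> (\<lambda>t\<in>K. c i * u i t) = c i * \<Phi> (u i)"
    using insert.prems by (auto intro: lip_funs_scale lip_functionalD[OF F])
  moreover have "?v \<in> lip_funs K" "\<Phi> ?v = (\<Sum>i\<in>I. c i * \<Phi> (u i))"
    using insert.IH insert.prems by blast+
  ultimately show ?case
    by (simp only: lip_funs_add lip_functionalD(1)[OF F] sum.insert[OF insert.hyps] simp_thms)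
qed

text \<open>
  For given \<open>s\<close> and \<open>t\<close> at most two of the functions are nonzero at \<open>s\<close> or at \<open>t\<close>, so every signed sum of the
  \<open>u i\<close> has Lipschitz constant at most \<open>2 * C\<close>, however many summands there are. Choosing as signs
  those of the \<open>\<Phi> (u i)\<close> turns the value of \<open>\<Phi>\<close> at this sum into the sum of the absolute values.
\<close>
lemma sum_abs_functional_disjoint_supports:
  assumes K: "s0 \<in> K" "t0 \<in> K" "s0 \<noteq> t0"
    and F: "lip_functional K \<Phi>"
    and B: "B \<ge> 0" "\<And>f. f \<in> lip_funs K \<Longrightarrow> \<bar>\<Phi> f\<bar> \<le> B * lip_seminorm K f"
    and I: "finite I" and u: "\<And>i. i \<in> I \<Longrightarrow> u i \<in> lip_funs K"
    and C0: "0 \<le> C" and C: "\<And>i s t. \<lbrakk>i \<in> I; s \<in> K; t \<in> K\<rbrakk> \<Longrightarrow> \<bar>u i s - u i t\<bar> \<le> C * dist s t"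
    and disj: "\<And>i j t. \<lbrakk>i \<in> I; j \<in> I; i \<noteq> j; t \<in> K\<rbrakk> \<Longrightarrow> u i t = 0 \<or> u j t = 0"
  shows "(\<Sum>i\<in>I. \<bar>\<Phi> (u i)\<bar>) \<le> B * (2 * C)"
proof -
  define U where "U = (\<lambda>t\<in>K. \<Sum>i\<in>I. sgn (\<Phi> (u i)) * u i t)"
  have U: "U \<in> lip_funs K" "\<Phi> U = (\<Sum>i\<in>I. sgn (\<Phi> (u i)) * \<Phi> (u i))"
    unfolding U_def using lip_functional_sum[OF F I u, where c = "\<lambda>i. sgn (\<Phi> (u i))"] by auto
  have "lip_seminorm K U \<le> 2 * C"
  proof (rule lip_seminorm_le[OF _ K])
    fix s t assume st: "s \<in> K" "t \<in> K"
    define A where "A r = {i\<in>I. u i r \<noteq> 0}" for r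
    have fin: "finite (A r)" for r using I by (simp add: A_def)
    have card: "card (A r) \<le> 1" if "r \<in> K" for r
      using disj that fin[of r] by (auto simp: card_le_Suc0_iff_eq A_def)
    show "\<bar>U s - U t\<bar> \<le> 2 * C * dist s t"
    proof -
      have "\<bar>U s - U t\<bar> = \<bar>\<Sum>i\<in>I. sgn (\<Phi> (u i)) * (u i s - u i t)\<bar>"
        using st by (simp add: U_def sum_subtractf right_diff_distrib)
      also have "\<dots> \<le> (\<Sum>i\<in>I. \<bar>u i s - u i t\<bar>)"
        by (intro order_trans[OF sum_abs] sum_mono) (simp add: abs_mult sgn_real_def)
      also have "\<dots> = (\<Sum>i\<in>A s \<union> A t. \<bar>u i s - u i t\<bar>)"
        by (rule sum.mono_neutral_right[OF I]) (auto simp: A_def)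
      also have "\<dots> \<le> (\<Sum>i\<in>A s \<union> A t. C * dist s t)"
        by (intro sum_mono C st) (auto simp: A_def)
      also have "\<dots> = real (card (A s \<union> A t)) * (C * dist s t)" by simp
      also have "\<dots> \<le> 2 * (C * dist s t)"
        using card_Un_le[of "A s" "A t"] card[OF st(1)] card[OF st(2)] C0
        by (intro mult_right_mono) auto
      finally show ?thesis by simp
    qed
  qed
  then have "B * lip_seminorm K U \<le> B * (2 * C)" using B(1) by (rule mult_left_mono)
  moreover have "(\<Sum>i\<in>I. \<bar>\<Phi> (u i)\<bar>) = \<Phi> U"
    unfolding U(2) by (intro sum.cong) (auto simp: abs_sgn mult.commute)
  ultimately show ?thesis using B(2)[OF U(1)] by linarith
qed

section \<open>Convex sets: making a function steep on a short piece\<close>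

text \<open>
  Lowering \<open>f\<close> to a cone with tip at \<open>q\<close>, whose height is chosen such that the slope from \<open>p\<close> to \<open>q\<close>
  becomes \<open>1\<close>. The cone rises slightly faster than slope \<open>1\<close>, with \<open>L\<close> just large enough that it
  stays above \<open>f\<close> outside the ball of radius \<open>R\<close> around \<open>p\<close>. When \<open>dist p q\<close> is much smaller than \<open>R\<close>,
  the constant \<open>L\<close> is close to \<open>1\<close>.
\<close>
lemma lipschitz_steepen:
  fixes f :: "'a::metric_space \<Rightarrow> real"
  assumes f: "\<And>s t. s \<in> K \<Longrightarrow> t \<in> K \<Longrightarrow> \<bar>f s - f t\<bar> \<le> dist s t"
    and pq: "p \<in> K" "q \<in> K" "p \<noteq> q" "dist p q < R"
  defines "L \<equiv> 1 + 2 * dist p q / (R - dist p q)"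
  defines "h \<equiv> (\<lambda>x\<in>K. min (f x) (f p - dist p q + L * dist x q))"
  shows "\<And>s t. s \<in> K \<Longrightarrow> t \<in> K \<Longrightarrow> \<bar>h s - h t\<bar> \<le> L * dist s t"
    and "\<And>x. x \<in> K \<Longrightarrow> R \<le> dist p x \<Longrightarrow> h x = f x"
    and "h p - h q = dist p q"
proof -
  have L: "L \<ge> 1" "(L - 1) * (R - dist p q) = 2 * dist p q" using pq by (auto simp: L_def)
  show "\<bar>h s - h t\<bar> \<le> L * dist s t" if "s \<in> K" "t \<in> K" for s t
  proof -
    have "\<bar>L * dist s q - L * dist t q\<bar> = L * \<bar>dist s q - dist t q\<bar>"
      using L by (simp add: right_diff_distrib[symmetric] abs_mult)
    also have "\<dots> \<le> L * dist s t"
      using L abs_dist_diff_le[of s q t] by (intro mult_left_mono) (auto simp: dist_commute)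
    finally have 1: "\<bar>L * dist s q - L * dist t q\<bar> \<le> L * dist s t" .
    have "1 * dist s t \<le> L * dist s t" using L by (intro mult_right_mono) auto
    then have "\<bar>f s - f t\<bar> \<le> L * dist s t" using f[OF that] by simp
    with 1 show ?thesis using that by (auto simp: h_def min_def abs_le_iff)
  qed
  show "h x = f x" if x: "x \<in> K" "R \<le> dist p x" for x
  proof -
    have tr: "dist p x \<le> dist p q + dist x q" by (metis dist_commute dist_triangle)
    have "2 * dist p q \<le> (L - 1) * dist x q"
      unfolding L(2)[symmetric] using L(1) x(2) tr by (intro mult_left_mono) auto
    moreover have "f x - f p \<le> dist p x" using f[OF pq(1) x(1)] by simp
    ultimately show ?thesis using tr x(1) by (simp add: h_def algebra_simps)
  qed
  have "1 * dist p q \<le> L * dist p q" using L by (intro mult_right_mono) auto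
  then show "h p - h q = dist p q" using f[OF pq(1,2)] pq by (auto simp: h_def min_def)
qed

text \<open>
  The decrease of \<open>g\<close> along the segment is the sum of the decreases over the \<open>n\<close> pieces, none of
  which exceeds the length of a piece. Hence a total loss of \<open>\<epsilon> / n\<close> relative to the maximal decrease
  can cost a single piece at most a loss of \<open>\<epsilon>\<close>.
\<close>
lemma steep_segments:
  fixes g :: "'e::real_normed_vector \<Rightarrow> real"
  assumes "convex K" and ab: "a \<in> K" "b \<in> K" and n: "n > 0"
    and g: "\<And>s t. s \<in> K \<Longrightarrow> t \<in> K \<Longrightarrow> \<bar>g s - g t\<bar> \<le> dist s t"
    and steep: "g a - g b \<ge> (1 - \<epsilon> / real n) * dist a b"
  defines "x \<equiv> \<lambda>k. a + (real k / real n) *\<^sub>R (b - a)"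
  shows "\<And>k. k \<le> n \<Longrightarrow> x k \<in> K"
    and "\<And>j k. dist (x j) (x k) = \<bar>real j - real k\<bar> * (dist a b / real n)"
    and "\<And>k. k < n \<Longrightarrow> g (x k) - g (x (Suc k)) \<ge> (1 - \<epsilon>) * (dist a b / real n)"
proof -
  show xK: "x k \<in> K" if "k \<le> n" for k
  proof -
    have "x k = (1 - real k / real n) *\<^sub>R a + (real k / real n) *\<^sub>R b"
      by (simp add: x_def algebra_simps)
    then show ?thesis using that n by (simp add: convexD_alt[OF assms(1) ab])
  qed
  show dx: "dist (x j) (x k) = \<bar>real j - real k\<bar> * (dist a b / real n)" for j k
  proof -
    have "x j - x k = ((real j - real k) / real n) *\<^sub>R (b - a)"
      by (simp add: x_def diff_divide_distrib scaleR_diff_left)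
    then show ?thesis by (simp add: dist_norm norm_minus_commute)
  qed
  define D where "D = dist a b / real n"
  show "g (x k) - g (x (Suc k)) \<ge> (1 - \<epsilon>) * (dist a b / real n)" if k: "k < n" for k
  proof -
    have x0: "x 0 = a" "x n = b" using n by (auto simp: x_def)
    have "g a - g b = (\<Sum>j<n. g (x j) - g (x (Suc j)))"
      using sum_lessThan_telescope'[of "\<lambda>j. g (x j)" n] x0 by simp
    also have "\<dots> = g (x k) - g (x (Suc k)) + (\<Sum>j\<in>{..<n}-{k}. g (x j) - g (x (Suc j)))"
      using k by (subst sum.remove[of _ k]) auto
    also have "(\<Sum>j\<in>{..<n}-{k}. g (x j) - g (x (Suc j))) \<le> (\<Sum>j\<in>{..<n}-{k}. D)"
    proof (rule sum_mono)
      fix j assume "j \<in> {..<n}-{k}"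
      then show "g (x j) - g (x (Suc j)) \<le> D"
        using g[OF xK xK, of j "Suc j"] by (simp add: dx D_def)
    qed
    also have "\<dots> = (real n - 1) * D" using k n by (simp add: of_nat_diff)
    finally have "g a - g b \<le> g (x k) - g (x (Suc k)) + (real n - 1) * D" by simp
    moreover have "(1 - \<epsilon> / real n) * dist a b = real n * D - \<epsilon> * D"
      using n by (simp add: D_def field_simps)
    ultimately show ?thesis using steep unfolding D_def[symmetric] by (simp add: algebra_simps)
  qed
qed

lemma lip_seminorm_gt_imp_pair:
  assumes "c < lip_seminorm K f" "s0 \<in> K" "t0 \<in> K" "s0 \<noteq> t0"
  obtains s t where "s \<in> K" "t \<in> K" "s \<noteq> t" "f s - f t > c * dist s t"
proof -
  obtain s t where st: "s \<in> K" "t \<in> K" "s \<noteq> t" "c < \<bar>f s - f t\<bar> / dist s t"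
    using assms(1) unfolding lip_seminorm_def by (rule less_cSupE) (use assms(2-4) in auto)
  then have "c * dist s t < \<bar>f s - f t\<bar>" by (simp add: less_divide_eq)
  then show ?thesis using that[of s t] that[of t s] st by (auto simp: abs_if dist_commute split: if_splits)
qed

text \<open>
  The steep segment is cut into \<open>N\<close> long pieces, each of them cut into \<open>m\<close> short ones. The function
  \<open>f\<close> is modified on the first short piece of a long one, inside a ball whose radius is half the
  length of a long piece. A large \<open>m\<close> keeps the norm of the modification small, and a large \<open>N\<close>
  produces a modification that \<open>\<Phi>\<close> hardly notices.
\<close>
lemma convex_perturbation:
  fixes K :: "'e::real_normed_vector set"
  assumes K: "s0 \<in> K" "t0 \<in> K" "s0 \<noteq> t0" and "convex K"
    and f: "f \<in> lip_funs K" "lip_seminorm K f \<le> 1"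
    and g: "g \<in> lip_funs K" "lip_seminorm K g = 1"
    and F: "lip_functional K \<Phi>" and \<epsilon>: "0 < \<epsilon>" "\<epsilon> \<le> 1"
  obtains h p q where "h \<in> lip_funs K" "lip_seminorm K h \<le> 1 + \<epsilon>" "\<bar>\<Phi> h - \<Phi> f\<bar> \<le> \<epsilon>"
    "p \<in> K" "q \<in> K" "p \<noteq> q" "h p - h q = dist p q" "g p - g q \<ge> (1 - \<epsilon>) * dist p q"
proof -
  obtain B where B: "B \<ge> 0" "\<And>f. f \<in> lip_funs K \<Longrightarrow> \<bar>\<Phi> f\<bar> \<le> B * lip_seminorm K f"
    using lip_functional_bound[OF F K] by blast
  obtain N :: nat where N: "6 * B / \<epsilon> < real N" using reals_Archimedean2 by blast
  have "0 \<le> 6 * B / \<epsilon>" using B(1) \<epsilon> by simp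
  with N have N0: "N > 0" by (auto intro: ccontr)
  obtain m :: nat where m: "2 + 4 / \<epsilon> < real m" using reals_Archimedean2 by blast
  have "0 < 4 / \<epsilon>" using \<epsilon> by simp
  with m have m2: "real m > 2" by linarith
  define n where "n = N * m"
  have n: "n > 0" using N0 m2 by (auto simp: n_def intro: ccontr)
  have "1 - \<epsilon> / real n < lip_seminorm K g" using \<epsilon> n g(2) by simp
  then obtain a b where ab: "a \<in> K" "b \<in> K" "a \<noteq> b" "g a - g b > (1 - \<epsilon> / real n) * dist a b"
    by (rule lip_seminorm_gt_imp_pair[OF _ K])
  have f1: "\<bar>f s - f t\<bar> \<le> dist s t" if "s \<in> K" "t \<in> K" for s t
    using lip_seminorm_quot_le[OF f(1) that] mult_right_mono[OF f(2), of "dist s t"] by simp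
  have g1: "\<bar>g s - g t\<bar> \<le> dist s t" if "s \<in> K" "t \<in> K" for s t
    using lip_seminorm_quot_le[OF g(1) that] g(2) by simp
  define x where "x k = a + (real k / real n) *\<^sub>R (b - a)" for k
  define D where "D = dist a b / real n"
  have D: "D > 0" using ab n by (simp add: D_def)
  note seg = steep_segments[OF \<open>convex K\<close> ab(1,2) n g1 less_imp_le[OF ab(4)],
      folded x_def D_def]
  define p where "p i = x (i * m)" for i
  define q where "q i = x (Suc (i * m))" for i
  define R where "R = real m / 2 * D"
  have le: "Suc (i * m) \<le> n" if "i < N" for i
  proof -
    have "i * m + m \<le> N * m" using that by (metis Suc_leI add.commute mult_Suc mult_le_mono1)
    moreover have "1 \<le> m" using m2 by simp
    ultimately show ?thesis unfolding n_def by linarith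
  qed
  have pq: "p i \<in> K" "q i \<in> K" "dist (p i) (q i) = D" "g (p i) - g (q i) \<ge> (1 - \<epsilon>) * D"
    if "i < N" for i
    using seg(1)[of "i * m"] seg(1)[of "Suc (i * m)"] seg(3)[of "i * m"] le[OF that]
    by (auto simp: p_def q_def seg(2))
  have pq': "p i \<noteq> q i" if "i < N" for i using pq(3)[OF that] D by auto
  have DR: "D < R" using D m2 by (simp add: R_def)
  define L where "L = 1 + 2 * D / (R - D)"
  \<comment> \<open>the excess of the Lipschitz constant over \<open>1\<close>; the choice of \<open>m\<close> makes it at most \<open>\<epsilon>\<close>\<close>
  have "2 * D / (R - D) = 4 / (real m - 2)"
    using D m2 by (simp add: R_def divide_simps) (simp add: algebra_simps)
  also have "\<dots> \<le> \<epsilon>" using m m2 \<epsilon> by (simp add: field_simps)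
  finally have L: "L \<le> 1 + \<epsilon>" by (simp add: L_def)
  define h where "h i = (\<lambda>y\<in>K. min (f y) (f (p i) - D + L * dist y (q i)))" for i
  have h: "\<And>s t. s \<in> K \<Longrightarrow> t \<in> K \<Longrightarrow> \<bar>h i s - h i t\<bar> \<le> L * dist s t"
    "\<And>y. y \<in> K \<Longrightarrow> R \<le> dist (p i) y \<Longrightarrow> h i y = f y"
    "h i (p i) - h i (q i) = D" if "i < N" for i
    using lipschitz_steepen[of K f "p i" "q i" R, OF f1 pq(1,2)[OF that] pq'[OF that]] DR
    unfolding pq(3)[OF that] L_def[symmetric] h_def[symmetric] by auto
  have hin: "h i \<in> lip_funs K" if "i < N" for i
    by (rule lip_funs_of_bound[OF _ h(1)[OF that]]) (simp only: h_def restrict_extensional)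
  define u where "u i = (\<lambda>t\<in>K. h i t - f t)" for i
  have uin: "u i \<in> lip_funs K" if "i \<in> {..<N}" for i
    unfolding u_def using that by (intro lip_funs_diff hin f(1)) auto
  \<comment> \<open>each \<open>u i\<close> is the difference of a \<open>2\<close>-Lipschitz and a \<open>1\<close>-Lipschitz function\<close>
  have "(\<Sum>i<N. \<bar>\<Phi> (u i)\<bar>) \<le> B * (2 * 3)"
  proof (rule sum_abs_functional_disjoint_supports[OF K F B _ uin])
    fix i s t assume i: "i \<in> {..<N}" and st: "s \<in> K" "t \<in> K"
    have "L * dist s t \<le> 2 * dist s t" using L \<epsilon> by (intro mult_right_mono) auto
    then show "\<bar>u i s - u i t\<bar> \<le> 3 * dist s t"
      using h(1)[of i s t] f1[OF st] i st by (simp add: u_def)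
  next
    fix i j t assume ij: "i \<in> {..<N}" "j \<in> {..<N}" "i \<noteq> j" and t: "t \<in> K"
    have "1 * (real m * D) \<le> \<bar>real i - real j\<bar> * (real m * D)"
      using ij(3) D by (intro mult_right_mono) auto
    also have "\<dots> = dist (p i) (p j)"
      by (simp add: p_def seg(2) left_diff_distrib[symmetric] abs_mult)
    also have "\<dots> \<le> dist (p i) t + dist (p j) t" by (rule dist_triangle2)
    finally have "R \<le> dist (p i) t \<or> R \<le> dist (p j) t" by (auto simp: R_def)
    then show "u i t = 0 \<or> u j t = 0" using h(2) ij t by (auto simp: u_def)
  qed auto
  also have "\<dots> < real N * \<epsilon>" using N \<epsilon> by (simp add: field_simps)
  finally have sum: "(\<Sum>i<N. \<bar>\<Phi> (u i)\<bar>) < real N * \<epsilon>" .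
  have "\<exists>i<N. \<bar>\<Phi> (u i)\<bar> < \<epsilon>"
  proof (rule ccontr)
    assume "\<not> ?thesis"
    then have "\<epsilon> \<le> \<bar>\<Phi> (u i)\<bar>" if "i \<in> {..<N}" for i using that by (meson lessThan_iff not_less)
    then have "real (card {..<N}) * \<epsilon> \<le> (\<Sum>i<N. \<bar>\<Phi> (u i)\<bar>)" by (rule sum_bounded_below)
    then show False using sum by simp
  qed
  then obtain i where i: "i < N" "\<bar>\<Phi> (u i)\<bar> < \<epsilon>" by blast
  show ?thesis
  proof (rule that[of "h i" "p i" "q i"])
    have "lip_seminorm K (h i) \<le> L" by (rule lip_seminorm_le[OF h(1)[OF i(1)] K])
    then show "lip_seminorm K (h i) \<le> 1 + \<epsilon>" using L by simp
    show "\<bar>\<Phi> (h i) - \<Phi> f\<bar> \<le> \<epsilon>"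
      using i(2) lip_functional_diff[OF F hin[OF i(1)] f(1)] by (simp add: u_def)
  qed (use hin pq pq' h(3) i(1) in auto)
qed

lemma convex_imp_daugavet_property_Lip:
  fixes K :: "'e::real_normed_vector set"
  assumes K: "s0 \<in> K" "t0 \<in> K" "s0 \<noteq> t0" and "convex K"
  shows "daugavet_property (Lip K)"
proof (rule daugavet_property_Lip_iff[OF K, THEN iffD2], intro allI impI, elim conjE)
  fix g \<Phi> assume g: "g \<in> lip_funs K" "lip_seminorm K g = 1"
    and F: "lip_functional K \<Phi>" and ex: "\<exists>f\<in>lip_funs K. \<Phi> f \<noteq> 0"
  define U where "U = {f \<in> lip_funs K. lip_seminorm K f \<le> 1}"
  define S where "S = (SUP f\<in>U. lip_seminorm K (\<lambda>t\<in>K. f t + \<Phi> f * g t))"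
  define c where "c = (SUP f\<in>U. \<bar>\<Phi> f\<bar>)"
  obtain B where B: "B \<ge> 0" "\<And>f. f \<in> lip_funs K \<Longrightarrow> \<bar>\<Phi> f\<bar> \<le> B * lip_seminorm K f"
    using lip_functional_bound[OF F K] by blast
  have BU: "\<bar>\<Phi> f\<bar> \<le> B" if "f \<in> U" for f
    using B(2)[of f] that B(1) mult_left_le[of "lip_seminorm K f" B] by (auto simp: U_def)
  have c: "\<bar>\<Phi> f\<bar> \<le> c" if "f \<in> U" for f
    unfolding c_def using that BU by (intro cSUP_upper bdd_aboveI2[of _ _ B])
  have U0: "(\<lambda>t\<in>K. 0) \<in> U"
    using lip_seminorm_le[of K "\<lambda>t\<in>K. 0" 1, OF _ K] lip_funs_zero[of K] unfolding U_def by simp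
  have sum_in: "(\<lambda>t\<in>K. f t + \<Phi> f * g t) \<in> lip_funs K"
      "lip_seminorm K (\<lambda>t\<in>K. f t + \<Phi> f * g t) \<le> lip_seminorm K f + \<bar>\<Phi> f\<bar>"
    if f: "f \<in> lip_funs K" for f
  proof -
    have eq: "(\<lambda>t\<in>K. f t + (\<lambda>t\<in>K. \<Phi> f * g t) t) = (\<lambda>t\<in>K. f t + \<Phi> f * g t)" by auto
    note gs = lip_funs_scale[OF g(1), of "\<Phi> f"]
    show "(\<lambda>t\<in>K. f t + \<Phi> f * g t) \<in> lip_funs K" using lip_funs_add[OF f gs] by (simp only: eq)
    show "lip_seminorm K (\<lambda>t\<in>K. f t + \<Phi> f * g t) \<le> lip_seminorm K f + \<bar>\<Phi> f\<bar>"
      using lip_seminorm_add_le[OF f gs K, unfolded eq] lip_seminorm_scale[OF g(1) K, of "\<Phi> f"] g(2)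
      by simp
  qed
  have Sle: "lip_seminorm K (\<lambda>t\<in>K. f t + \<Phi> f * g t) \<le> 1 + c" if "f \<in> U" for f
    using sum_in(2)[of f] c[OF that] that by (auto simp: U_def)
  have S: "lip_seminorm K (\<lambda>t\<in>K. f t + \<Phi> f * g t) \<le> S" if "f \<in> U" for f
    unfolding S_def using that Sle by (intro cSUP_upper bdd_aboveI2[of _ _ "1 + c"])
  have "S \<le> 1 + c" unfolding S_def using U0 Sle by (intro cSUP_least) auto
  moreover have "1 + c \<le> S"
  proof -
    obtain f0 where f0: "f0 \<in> lip_funs K" "\<Phi> f0 \<noteq> 0" using ex by blast
    define l where "l = lip_seminorm K f0 + 1"
    have l: "l > 0" "lip_seminorm K f0 \<le> l"
      using lip_seminorm_nonneg[OF f0(1) K] by (auto simp: l_def)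
    have "(\<lambda>t\<in>K. (1 / l) * f0 t) \<in> U"
      unfolding U_def using lip_funs_scale[OF f0(1), of "1 / l"]
        lip_seminorm_scale[OF f0(1) K, of "1 / l"] l by simp
    from c[OF this] have "\<bar>\<Phi> f0\<bar> / l \<le> c"
      using lip_functionalD(2)[OF F f0(1), of "1 / l"] l(1) by simp
    moreover have "0 < \<bar>\<Phi> f0\<bar> / l" using f0(2) l(1) by simp
    ultimately have c0: "c > 0" by linarith
    have key: "1 + (c - 2 * \<epsilon>) * (1 - \<epsilon>) \<le> S * (1 + \<epsilon>)" if \<epsilon>: "0 < \<epsilon>" "\<epsilon> \<le> 1" "2 * \<epsilon> \<le> c" for \<epsilon>
    proof -
      have "\<exists>f\<in>U. c - \<epsilon> < \<bar>\<Phi> f\<bar>"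
      proof (rule less_cSupE[of "c - \<epsilon>" "(\<lambda>f. \<bar>\<Phi> f\<bar>) ` U"])
        show "c - \<epsilon> < (SUP f\<in>U. \<bar>\<Phi> f\<bar>)" using \<epsilon> by (simp add: c_def)
      qed (use U0 in auto)
      then obtain f1 where f1: "f1 \<in> U" "c - \<epsilon> < \<bar>\<Phi> f1\<bar>" by blast
      have "\<exists>f\<in>U. c - \<epsilon> < \<Phi> f"
      proof (cases "\<Phi> f1 \<ge> 0")
        case False
        let ?f = "\<lambda>t\<in>K. - 1 * f1 t"
        have "?f \<in> U" using f1(1) lip_seminorm_scale[OF _ K, of f1 "-1"] lip_funs_scale[of f1 K "-1"]
          by (simp add: U_def)
        moreover have "\<Phi> ?f = - \<Phi> f1"
          using lip_functionalD(2)[OF F, of f1 "-1"] f1(1) by (simp add: U_def)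
        ultimately show ?thesis using False f1(2) by (intro bexI[of _ ?f]) auto
      qed (use f1 in auto)
      then obtain f where f: "f \<in> lip_funs K" "lip_seminorm K f \<le> 1" "c - \<epsilon> < \<Phi> f"
        by (auto simp: U_def)
      obtain h p q where h: "h \<in> lip_funs K" "lip_seminorm K h \<le> 1 + \<epsilon>" "\<bar>\<Phi> h - \<Phi> f\<bar> \<le> \<epsilon>"
        and pq: "p \<in> K" "q \<in> K" "p \<noteq> q" "h p - h q = dist p q" "g p - g q \<ge> (1 - \<epsilon>) * dist p q"
        by (rule convex_perturbation[OF K \<open>convex K\<close> f(1,2) g F \<epsilon>(1,2)])
      \<comment> \<open>scaled back into the unit ball\<close>
      define k where "k = (\<lambda>t\<in>K. (1 / (1 + \<epsilon>)) * h t)"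
      have k: "k \<in> U" "\<Phi> k = \<Phi> h / (1 + \<epsilon>)"
        unfolding k_def U_def
        using h(2) \<epsilon> lip_funs_scale[OF h(1), of "1 / (1 + \<epsilon>)"]
          lip_seminorm_scale[OF h(1) K, of "1 / (1 + \<epsilon>)"]
          lip_functionalD(2)[OF F h(1), of "1 / (1 + \<epsilon>)"]
        by simp_all
      define d where "d = dist p q"
      have d: "d > 0" using pq(3) by (simp add: d_def)
      have "lip_seminorm K (\<lambda>t\<in>K. k t + \<Phi> k * g t) * d \<le> S * d"
        using S[OF k(1)] d by (intro mult_right_mono) auto
      then have "(k p + \<Phi> k * g p) - (k q + \<Phi> k * g q) \<le> S * d"
        using lip_seminorm_quot_le[OF sum_in(1) pq(1,2), of k] k(1) pq(1,2)
        by (simp add: U_def d_def)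
      moreover have "(k p + \<Phi> k * g p) - (k q + \<Phi> k * g q) = (d + \<Phi> h * (g p - g q)) / (1 + \<epsilon>)"
      proof -
        have "k p = h p / (1 + \<epsilon>)" "k q = h q / (1 + \<epsilon>)" using pq(1,2) by (simp_all add: k_def)
        moreover have "d = h p - h q" using pq(4) by (simp add: d_def)
        ultimately show ?thesis
          unfolding k(2) by (simp add: add_divide_distrib diff_divide_distrib right_diff_distrib)
      qed
      ultimately have "d + \<Phi> h * (g p - g q) \<le> S * d * (1 + \<epsilon>)"
        using \<epsilon> by (simp add: pos_divide_le_eq)
      moreover have "(c - 2 * \<epsilon>) * ((1 - \<epsilon>) * d) \<le> \<Phi> h * (g p - g q)"
        using h(3) f(3) \<epsilon> pq(5) d by (intro mult_mono) (auto simp: d_def)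
      ultimately have "(1 + (c - 2 * \<epsilon>) * (1 - \<epsilon>)) * d \<le> (S * (1 + \<epsilon>)) * d"
        by (simp add: algebra_simps)
      then show ?thesis using d by (rule mult_right_le_imp_le)
    qed
    have "((\<lambda>\<epsilon>. S * (1 + \<epsilon>)) \<longlongrightarrow> S * (1 + 0)) (at_right 0)"
      "((\<lambda>\<epsilon>. 1 + (c - 2 * \<epsilon>) * (1 - \<epsilon>)) \<longlongrightarrow> 1 + (c - 2 * 0) * (1 - 0)) (at_right 0)"
      by (rule tendsto_intros)+
    moreover have "\<forall>\<^sub>F \<epsilon> in at_right 0. 1 + (c - 2 * \<epsilon>) * (1 - \<epsilon>) \<le> S * (1 + \<epsilon>)"
      using key c0 by (auto simp: eventually_at_right_field intro!: exI[of _ "min 1 (c / 2)"])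
    ultimately show ?thesis using tendsto_le[OF trivial_limit_at_right_real] by fastforce
  qed
  ultimately show "(SUP f\<in>{f \<in> lip_funs K. lip_seminorm K f \<le> 1}.
      lip_seminorm K (\<lambda>t\<in>K. f t + \<Phi> f * g t)) = 1 + (SUP f\<in>{f \<in> lip_funs K. lip_seminorm K f \<le> 1}. \<bar>\<Phi> f\<bar>)"
    unfolding U_def[symmetric] S_def[symmetric] c_def[symmetric] by simp
qed

section \<open>Compact sets: the Daugavet property makes slopes local\<close>

lemma functional_average_of_slopes:
  assumes K: "s0 \<in> K" "t0 \<in> K" "s0 \<noteq> t0"
    and A: "finite A" "A \<noteq> {}" "\<And>a b. (a, b) \<in> A \<Longrightarrow> a \<in> K \<and> b \<in> K \<and> a \<noteq> b"
  defines "\<psi> \<equiv> \<lambda>f. (\<Sum>(a, b)\<in>A. (f a - f b) / dist a b) / real (card A)"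
  shows "lip_functional K \<psi>" "\<And>f. f \<in> lip_funs K \<Longrightarrow> \<bar>\<psi> f\<bar> \<le> lip_seminorm K f"
proof -
  have n: "real (card A) > 0" using A by (simp add: card_gt_0_iff)
  have cong: "\<psi> (\<lambda>t\<in>K. f t) = \<psi> f" for f
    unfolding \<psi>_def by (intro arg_cong2[of _ _ _ _ "(/)"] sum.cong refl) (use A(3) in auto)
  have add: "\<psi> (\<lambda>t. f t + g t) = \<psi> f + \<psi> g" for f g
  proof -
    have "(\<Sum>(a, b)\<in>A. ((f a + g a) - (f b + g b)) / dist a b)
        = (\<Sum>(a, b)\<in>A. (f a - f b) / dist a b) + (\<Sum>(a, b)\<in>A. (g a - g b) / dist a b)"
      unfolding sum.distrib[symmetric]
      by (intro sum.cong refl) (auto simp: add_divide_distrib[symmetric])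
    then show ?thesis by (simp add: \<psi>_def add_divide_distrib)
  qed
  have scale: "\<psi> (\<lambda>t. c * f t) = c * \<psi> f" for c f
  proof -
    have "(\<Sum>(a, b)\<in>A. (c * f a - c * f b) / dist a b) = c * (\<Sum>(a, b)\<in>A. (f a - f b) / dist a b)"
      unfolding sum_distrib_left
      by (intro sum.cong refl) (auto simp: right_diff_distrib[symmetric])
    then show ?thesis by (simp add: \<psi>_def)
  qed
  show bound: "\<bar>\<psi> f\<bar> \<le> lip_seminorm K f" if f: "f \<in> lip_funs K" for f
  proof -
    have "\<bar>\<Sum>(a, b)\<in>A. (f a - f b) / dist a b\<bar> \<le> (\<Sum>z\<in>A. lip_seminorm K f)"
    proof (rule order_trans[OF sum_abs], rule sum_mono)
      fix z assume "z \<in> A"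
      then obtain a b where "z = (a, b)" "a \<in> K" "b \<in> K" "a \<noteq> b" using A(3) by (cases z) auto
      then show "\<bar>case z of (a, b) \<Rightarrow> (f a - f b) / dist a b\<bar> \<le> lip_seminorm K f"
        using lip_seminorm_quot_le[OF f, of a b] by (simp add: abs_divide divide_le_eq)
    qed
    then show ?thesis using n by (simp add: \<psi>_def abs_divide divide_le_eq mult.commute)
  qed
  show "lip_functional K \<psi>"
    unfolding lip_functional_def cong add scale using bound
    by (auto intro!: exI[of _ 1])
qed

text \<open>
  If \<open>\<Phi>\<close> has norm \<open>1\<close>, attained at \<open>g\<close>, the Daugavet equation reads
  \<open>sup \<parallel>f + \<Phi> f \<cdot> g\<parallel> = 2\<close>; some slope of some \<open>f + \<Phi> f \<cdot> g\<close> is thus almost \<open>2\<close>.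
\<close>
lemma daugavet_property_Lip_imp_pair:
  assumes K: "s0 \<in> K" "t0 \<in> K" "s0 \<noteq> t0"
    and D: "daugavet_property (Lip K)"
    and g: "g \<in> lip_funs K" "lip_seminorm K g = 1"
    and F: "lip_functional K \<Phi>" and \<Phi>: "\<And>f. f \<in> lip_funs K \<Longrightarrow> \<bar>\<Phi> f\<bar> \<le> lip_seminorm K f" "\<bar>\<Phi> g\<bar> = 1"
    and \<eta>: "\<eta> > 0"
  obtains f s t where "f \<in> lip_funs K" "lip_seminorm K f \<le> 1" "s \<in> K" "t \<in> K" "s \<noteq> t"
    "(f s - f t) + \<Phi> f * (g s - g t) > (2 - \<eta>) * dist s t"
proof -
  define U where "U = {f \<in> lip_funs K. lip_seminorm K f \<le> 1}"
  have gU: "g \<in> U" using g by (simp add: U_def)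
  have bdd: "\<bar>\<Phi> f\<bar> \<le> 1" if "f \<in> U" for f using \<Phi>(1)[of f] that by (auto simp: U_def)
  have "\<exists>f\<in>lip_funs K. \<Phi> f \<noteq> 0" using g(1) \<Phi>(2) by (intro bexI[of _ g]) auto
  then have "(SUP f\<in>U. lip_seminorm K (\<lambda>t\<in>K. f t + \<Phi> f * g t)) = 1 + (SUP f\<in>U. \<bar>\<Phi> f\<bar>)"
    unfolding U_def
    by (intro daugavet_property_Lip_iff[OF K, THEN iffD1, OF D, rule_format] conjI g F)
  moreover have "\<bar>\<Phi> g\<bar> \<le> (SUP f\<in>U. \<bar>\<Phi> f\<bar>)"
    by (intro cSUP_upper gU bdd_aboveI2[of _ _ 1] bdd)
  ultimately have "2 - \<eta> < (SUP f\<in>U. lip_seminorm K (\<lambda>t\<in>K. f t + \<Phi> f * g t))"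
    using \<Phi>(2) \<eta> by simp
  then obtain r where "r \<in> (\<lambda>f. lip_seminorm K (\<lambda>t\<in>K. f t + \<Phi> f * g t)) ` U" "2 - \<eta> < r"
    by (rule less_cSupE) (use gU in auto)
  then obtain f where f: "f \<in> U" "2 - \<eta> < lip_seminorm K (\<lambda>t\<in>K. f t + \<Phi> f * g t)" by auto
  obtain s t where st: "s \<in> K" "t \<in> K" "s \<noteq> t"
    "(\<lambda>t\<in>K. f t + \<Phi> f * g t) s - (\<lambda>t\<in>K. f t + \<Phi> f * g t) t > (2 - \<eta>) * dist s t"
    by (rule lip_seminorm_gt_imp_pair[OF f(2) K])
  show ?thesis
    by (rule that[of f s t]) (use f(1) st in \<open>auto simp: U_def algebra_simps\<close>)
qed

lemma compact_slope_less_1: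
  fixes g :: "'a::metric_space \<Rightarrow> real"
  assumes C: "compact C" "\<And>s t. (s, t) \<in> C \<Longrightarrow> s \<in> K \<and> t \<in> K \<and> s \<noteq> t"
    and g: "continuous_on K g" and less: "\<And>s t. (s, t) \<in> C \<Longrightarrow> g s - g t < dist s t"
  shows "\<exists>v<1. \<forall>s t. (s, t) \<in> C \<longrightarrow> g s - g t \<le> v * dist s t"
proof (cases "C = {}")
  case True
  then show ?thesis by (auto intro: exI[of _ 0])
next
  case False
  define Q where "Q z = (g (fst z) - g (snd z)) / dist (fst z) (snd z)" for z
  have "fst ` C \<subseteq> K" "snd ` C \<subseteq> K" using C(2) by auto
  then have "continuous_on C (\<lambda>z. g (fst z))" "continuous_on C (\<lambda>z. g (snd z))"
    by (auto intro!: continuous_on_compose2[OF g] continuous_intros)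
  moreover have "\<forall>z\<in>C. dist (fst z) (snd z) \<noteq> 0" using C(2) by auto
  ultimately have "continuous_on C Q"
    unfolding Q_def by (intro continuous_intros)
  then obtain z where z: "z \<in> C" "\<forall>y\<in>C. Q y \<le> Q z"
    using continuous_attains_sup[OF C(1) False] by blast
  show ?thesis
  proof (intro exI[of _ "Q z"] conjI allI impI)
    show "Q z < 1" using less[of "fst z" "snd z"] C(2)[of "fst z" "snd z"] z(1)
      by (simp add: Q_def divide_less_eq)
    show "g s - g t \<le> Q z * dist s t" if "(s, t) \<in> C" for s t
      using bspec[OF z(2) that] C(2)[OF that] by (simp add: Q_def divide_le_eq)
  qed
qed

text \<open>
  Suppose \<open>\<parallel>u\<parallel> > 1\<close> and normalize \<open>u\<close> to \<open>g\<close>. All pairs on which \<open>g\<close> has slope almost \<open>1\<close> are at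
  distance at least \<open>\<epsilon>\<close> and close to a finite set \<open>A\<close> of pairs on which \<open>g\<close> has slope exactly \<open>1\<close>. Let
  \<open>\<psi>\<close> be the average of the slopes over \<open>A\<close>. The functional \<open>- \<psi>\<close> has norm \<open>1\<close>, attained at \<open>g\<close>, so
  there is an \<open>h\<close> in the unit ball such that \<open>h - \<psi> h \<cdot> g\<close> has slope almost \<open>2\<close> on some pair
  \<open>(s, t)\<close>. Up to a sign, \<open>g\<close> and \<open>h\<close> have slope almost \<open>1\<close> there while \<open>\<psi> h\<close> is almost \<open>- 1\<close>. Then
  the slope of \<open>h\<close> is negative on every pair of \<open>A\<close>, in particular on one close to \<open>(s, t)\<close>. As the
  points of these pairs are far apart compared with the distance between the pairs, this is
  impossible.
\<close>
lemma daugavet_property_Lip_imp_local: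
  fixes K :: "'a::metric_space set"
  assumes K: "s0 \<in> K" "t0 \<in> K" "s0 \<noteq> t0" and "compact K"
    and D: "daugavet_property (Lip K)"
    and u: "u \<in> lip_funs K" and \<epsilon>: "\<epsilon> > 0"
    and loc: "\<And>s t. \<lbrakk>s \<in> K; t \<in> K; dist s t < \<epsilon>\<rbrakk> \<Longrightarrow> \<bar>u s - u t\<bar> \<le> dist s t"
  shows "lip_seminorm K u \<le> 1"
proof (rule ccontr)
  assume not: "\<not> ?thesis"
  define l where "l = lip_seminorm K u"
  have l: "l > 1" using not by (simp add: l_def)
  define g where "g = (\<lambda>t\<in>K. (1 / l) * u t)"
  have g: "g \<in> lip_funs K" "lip_seminorm K g = 1"
    unfolding g_def using lip_funs_scale[OF u, of "1 / l"] lip_seminorm_scale[OF u K, of "1 / l"] l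
    by (auto simp: l_def)
  have g1: "\<bar>g s - g t\<bar> \<le> dist s t" if "s \<in> K" "t \<in> K" for s t
    using lip_seminorm_quot_le[OF g(1) that] g(2) by simp
  have gloc: "\<bar>g s - g t\<bar> \<le> 1 / l * dist s t" if "s \<in> K" "t \<in> K" "dist s t < \<epsilon>" for s t
    using loc[OF that] l that(1,2)
    by (simp add: g_def diff_divide_distrib[symmetric] abs_divide divide_right_mono)
  obtain L where "L-lipschitz_on K g" using g(1) by (auto simp: lip_funs_def)
  then have gcont: "continuous_on K g" by (rule lipschitz_on_continuous_on)
  \<comment> \<open>the pairs about which the local hypothesis says nothing\<close>
  define E where "E = K \<times> K \<inter> (\<lambda>z. dist (fst z) (snd z)) -` {\<epsilon>..}"
  have "closed E"
    unfolding E_def by (intro continuous_closed_preimage continuous_intros closed_Times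
        compact_imp_closed \<open>compact K\<close> closed_atLeast)
  then have "compact (K \<times> K \<inter> E)" by (intro compact_Int_closed compact_Times \<open>compact K\<close>)
  moreover have "K \<times> K \<inter> E = E" by (auto simp: E_def)
  ultimately have "compact E" by simp
  have E: "s \<in> K \<and> t \<in> K \<and> s \<noteq> t" if "(s, t) \<in> E" for s t using that \<epsilon> by (auto simp: E_def)
  define M where "M = {z \<in> E. g (fst z) - g (snd z) - dist (fst z) (snd z) = 0}"
  have "fst ` E \<subseteq> K" "snd ` E \<subseteq> K" by (auto simp: E_def)
  then have "closed M"
    unfolding M_def using \<open>closed E\<close>
    by (intro continuous_closed_preimage_constant continuous_intros continuous_on_compose2[OF gcont])
  then have "compact (E \<inter> M)" by (rule compact_Int_closed[OF \<open>compact E\<close>])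
  moreover have "E \<inter> M = M" by (auto simp: M_def)
  ultimately have "compact M" by simp
  have M: "(s, t) \<in> E \<and> g s - g t = dist s t \<and> s \<in> K \<and> t \<in> K \<and> s \<noteq> t" if "(s, t) \<in> M" for s t
    using that E by (auto simp: M_def)
  have "M \<subseteq> (\<Union>z\<in>M. ball z (\<epsilon> / 8))" using \<epsilon> by auto
  then obtain A where A: "A \<subseteq> M" "finite A" "M \<subseteq> (\<Union>z\<in>A. ball z (\<epsilon> / 8))"
    by (rule compactE_image[OF \<open>compact M\<close> open_ball])
  define C where "C = E - (\<Union>z\<in>A. ball z (\<epsilon> / 8))"
  have "compact C" unfolding C_def by (intro compact_diff \<open>compact E\<close> open_UN) auto
  have C1: "g s - g t < dist s t" if "(s, t) \<in> C" for s t
  proof -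
    have "(s, t) \<in> E" "(s, t) \<notin> M" using that A(3) by (auto simp: C_def)
    then show ?thesis using g1[of s t] E[of s t] by (auto simp: M_def)
  qed
  have CK: "s \<in> K \<and> t \<in> K \<and> s \<noteq> t" if "(s, t) \<in> C" for s t
    using that by (intro E) (simp add: C_def)
  obtain v where v: "v < 1" "\<And>s t. (s, t) \<in> C \<Longrightarrow> g s - g t \<le> v * dist s t"
    using compact_slope_less_1[OF \<open>compact C\<close> CK gcont C1] by blast
  \<comment> \<open>slopes above \<open>w\<close> occur neither at distance less than \<open>\<epsilon>\<close> nor away from \<open>A\<close>\<close>
  define w where "w = max v (1 / l)"
  have w: "w < 1" "v \<le> w" "1 / l \<le> w" using v(1) l by (auto simp: w_def)
  have near: "\<exists>a b. (a, b) \<in> A \<and> dist a s < \<epsilon> / 8 \<and> dist b t < \<epsilon> / 8 \<and> \<epsilon> \<le> dist s t"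
    if st: "s \<in> K" "t \<in> K" "g s - g t > w * dist s t" for s t
  proof -
    have "1 / l * dist s t \<le> w * dist s t" "v * dist s t \<le> w * dist s t"
      using w by (intro mult_right_mono zero_le_dist; simp)+
    then have "\<epsilon> \<le> dist s t" "(s, t) \<notin> C"
      using gloc[OF st(1,2)] st(3) v(2)[of s t] by linarith+
    then have "(s, t) \<in> (\<Union>z\<in>A. ball z (\<epsilon> / 8))" using st by (auto simp: C_def E_def)
    then obtain a b where ab: "(a, b) \<in> A" "dist (a, b) (s, t) < \<epsilon> / 8" by auto
    then show ?thesis
      using dist_fst_le[of "(a, b)" "(s, t)"] dist_snd_le[of "(a, b)" "(s, t)"] \<open>\<epsilon> \<le> dist s t\<close>
      by (intro exI[of _ a] exI[of _ b]) auto
  qed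
  have "w < lip_seminorm K g" using w g(2) by simp
  then obtain s1 t1 where "s1 \<in> K" "t1 \<in> K" "g s1 - g t1 > w * dist s1 t1"
    by (rule lip_seminorm_gt_imp_pair[OF _ K])
  from near[OF this] have "A \<noteq> {}" by blast
  define N where "N = real (card A)"
  have N: "N > 0" using \<open>A \<noteq> {}\<close> A(2) by (simp add: N_def card_gt_0_iff)
  define \<psi> where "\<psi> f = (\<Sum>(a, b)\<in>A. (f a - f b) / dist a b) / real (card A)" for f :: "'a \<Rightarrow> real"
  have AM: "a \<in> K \<and> b \<in> K \<and> a \<noteq> b" "g a - g b = dist a b" if "(a, b) \<in> A" for a b
    using M[of a b] that A(1) by auto
  have \<psi>: "lip_functional K \<psi>" "\<And>f. f \<in> lip_funs K \<Longrightarrow> \<bar>\<psi> f\<bar> \<le> lip_seminorm K f"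
    unfolding \<psi>_def by (rule functional_average_of_slopes[OF K A(2) \<open>A \<noteq> {}\<close> AM(1)]; assumption)+
  \<comment> \<open>\<open>\<eta> \<le> 1 / N\<close> is what turns an average close to \<open>- 1\<close> into \<open>N\<close> slopes that are all negative\<close>
  define \<eta> where "\<eta> = min (1 / 2) (min (1 - w) (1 / N))"
  have \<eta>: "\<eta> > 0" "\<eta> \<le> 1 / 2" "w \<le> 1 - \<eta>" "N * \<eta> \<le> 1"
  proof -
    have "\<eta> \<le> 1 - w" "\<eta> \<le> 1 / N" by (simp_all add: \<eta>_def)
    then show "w \<le> 1 - \<eta>" "N * \<eta> \<le> 1" using N by (simp_all add: le_divide_eq mult.commute)
    show "\<eta> > 0" using w N by (simp add: \<eta>_def)
    show "\<eta> \<le> 1 / 2" unfolding \<eta>_def by (rule min.cobounded1)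
  qed
  \<comment> \<open>the case of positive slopes on \<open>(s, t)\<close>; the other case is reduced to it by
      passing to \<open>- h\<close> and \<open>(t, s)\<close>\<close>
  have contra: False
    if h: "\<And>s t. \<lbrakk>s \<in> K; t \<in> K\<rbrakk> \<Longrightarrow> \<bar>h s - h t\<bar> \<le> dist s t"
      and st: "s \<in> K" "t \<in> K" "h s - h t > (1 - \<eta>) * dist s t" "g s - g t > (1 - \<eta>) * dist s t"
      and neg: "\<psi> h < - (1 - \<eta>)" for h s t
  proof -
    have "w * dist s t \<le> (1 - \<eta>) * dist s t" using \<eta>(3) by (intro mult_right_mono) auto
    with near[OF st(1,2)] st(4)
    obtain a b where ab: "(a, b) \<in> A" "dist a s < \<epsilon> / 8" "dist b t < \<epsilon> / 8" "\<epsilon> \<le> dist s t"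
      by fastforce
    \<comment> \<open>the other slopes are at least \<open>- 1\<close>, so the slope on \<open>(a, b)\<close> has to carry its share\<close>
    have "(\<Sum>z\<in>A - {(a, b)}. - 1) \<le> (\<Sum>(a, b)\<in>A - {(a, b)}. (h a - h b) / dist a b)"
    proof (rule sum_mono)
      fix z assume "z \<in> A - {(a, b)}"
      then obtain c d where "z = (c, d)" "c \<in> K" "d \<in> K" "c \<noteq> d" using AM(1) by (cases z) auto
      then show "- 1 \<le> (case z of (a, b) \<Rightarrow> (h a - h b) / dist a b)"
        using h[of c d] by (simp add: le_divide_eq abs_le_iff)
    qed
    then have "- (N - 1) \<le> (\<Sum>(a, b)\<in>A - {(a, b)}. (h a - h b) / dist a b)"
      using A(2) ab(1) N by (simp add: N_def of_nat_diff card_gt_0_iff Suc_le_eq)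
    moreover have "N * \<psi> h = (h a - h b) / dist a b + (\<Sum>(a, b)\<in>A - {(a, b)}. (h a - h b) / dist a b)"
      using N sum.remove[OF A(2) ab(1), of "\<lambda>(a, b). (h a - h b) / dist a b"]
      by (simp add: \<psi>_def N_def)
    moreover have "N * \<psi> h < N * - (1 - \<eta>)" using neg N by (intro mult_strict_left_mono)
    moreover have "N * - (1 - \<eta>) = N * \<eta> - N" by (simp add: algebra_simps)
    ultimately have "(h a - h b) / dist a b < 0" using \<eta>(4) by linarith
    then have "h a < h b" using AM(1)[OF ab(1)] by (simp add: divide_less_0_iff)
    moreover have "\<bar>h a - h s\<bar> < \<epsilon> / 8" "\<bar>h b - h t\<bar> < \<epsilon> / 8"
      using h[of a s] h[of b t] AM(1)[OF ab(1)] st(1,2) ab(2,3) by auto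
    moreover have "1 / 2 * \<epsilon> \<le> (1 - \<eta>) * dist s t"
      using \<eta> ab(4) \<epsilon> by (intro mult_mono) auto
    ultimately show False using st(3) by linarith
  qed
  have "\<psi> g = 1"
  proof -
    have "(\<Sum>(a, b)\<in>A. (g a - g b) / dist a b) = (\<Sum>z\<in>A. 1)"
      by (intro sum.cong refl) (use AM in auto)
    then show ?thesis using N by (simp add: \<psi>_def N_def)
  qed
  have "lip_functional K (\<lambda>f. - \<psi> f)"
    using \<psi>(1) unfolding lip_functional_def by auto
  then obtain h s t where h: "h \<in> lip_funs K" "lip_seminorm K h \<le> 1"
    and st: "s \<in> K" "t \<in> K" "s \<noteq> t"
      "(h s - h t) + - \<psi> h * (g s - g t) > (2 - \<eta>) * dist s t"
    by (rule daugavet_property_Lip_imp_pair[OF K D g _ _ _ \<eta>(1)]) (use \<psi>(2) \<open>\<psi> g = 1\<close> in auto)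
  have h1: "\<bar>h s - h t\<bar> \<le> dist s t" if "s \<in> K" "t \<in> K" for s t
    using lip_seminorm_quot_le[OF h(1) that] mult_right_mono[OF h(2), of "dist s t"] by simp
  have \<psi>1: "\<bar>\<psi> h\<bar> \<le> 1" using \<psi>(2)[OF h(1)] h(2) by simp
  define d where "d = dist s t"
  have d: "d > 0" using st by (simp add: d_def)
  have prod: "\<bar>\<psi> h * (g s - g t)\<bar> \<le> d" "\<bar>\<psi> h * (g s - g t)\<bar> \<le> \<bar>g s - g t\<bar>"
    "\<bar>\<psi> h * (g s - g t)\<bar> \<le> \<bar>\<psi> h\<bar> * d"
    using g1[OF st(1,2)] \<psi>1 mult_mono[of "\<bar>\<psi> h\<bar>" 1 "\<bar>g s - g t\<bar>" d]
      mult_right_mono[OF \<psi>1, of "\<bar>g s - g t\<bar>"]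
    by (auto simp: abs_mult d_def intro: mult_left_mono)
  have big: "h s - h t > (1 - \<eta>) * d" "- (\<psi> h * (g s - g t)) > (1 - \<eta>) * d"
    using st(4) prod(1) h1[OF st(1,2)] unfolding d_def[symmetric] by (auto simp: algebra_simps)
  have "(1 - \<eta>) * d > 0" using d \<eta>(2) by simp
  with big(2) have neg: "\<psi> h * (g s - g t) < 0" by linarith
  have "(1 - \<eta>) * d < \<bar>\<psi> h\<bar> * d" using big(2) prod(3) by linarith
  then have \<psi>big: "\<bar>\<psi> h\<bar> > 1 - \<eta>" using d by simp
  have gbig: "\<bar>g s - g t\<bar> > (1 - \<eta>) * d" using big(2) prod(2) by linarith
  show False
  proof (cases "\<psi> h < 0")
    case True
    then have "g s - g t > 0" using neg by (simp add: mult_less_0_iff)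
    show False
      by (rule contra[of h s t]) (use h1 st True \<open>g s - g t > 0\<close> \<psi>big gbig big in \<open>auto simp: d_def\<close>)
  next
    case False
    then have pos: "\<psi> h > 0" "g t - g s > 0" using neg by (auto simp: mult_less_0_iff)
    have "\<psi> (\<lambda>x. - h x) = - \<psi> h"
      by (simp add: \<psi>_def sum_negf[symmetric] minus_divide_left case_prod_unfold)
    then show False
      by (intro contra[of "\<lambda>x. - h x" t s])
        (use h1 st pos \<psi>big gbig big in \<open>auto simp: d_def dist_commute abs_minus_commute\<close>)
  qed
qed

section \<open>Short chains and midpoints\<close>

text \<open>
  A chain in \<open>K\<close> from \<open>a\<close> to the given point, with steps shorter than \<open>\<epsilon>\<close>; the number is the
  length of the chain.
\<close>
inductive chain_reach :: "'a::metric_space set \<Rightarrow> real \<Rightarrow> 'a \<Rightarrow> 'a \<Rightarrow> real \<Rightarrow> bool"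
  for K \<epsilon> a where
  start: "a \<in> K \<Longrightarrow> chain_reach K \<epsilon> a a 0"
| step: "\<lbrakk>chain_reach K \<epsilon> a s r; t \<in> K; dist s t < \<epsilon>\<rbrakk> \<Longrightarrow> chain_reach K \<epsilon> a t (r + dist s t)"

lemma chain_reach_nonneg: "chain_reach K \<epsilon> a t r \<Longrightarrow> 0 \<le> r"
  by (induction rule: chain_reach.induct) auto

lemma chain_reach_dist: "chain_reach K \<epsilon> a t r \<Longrightarrow> t \<in> K \<and> dist a t \<le> r"
proof (induction rule: chain_reach.induct)
  case (step s r t)
  then show ?case using dist_triangle[of a t s] by simp
qed simp

text \<open>
  Some point of the chain is reached after a length between \<open>l - \<epsilon>\<close> and \<open>l\<close>, because the steps are
  shorter than \<open>\<epsilon>\<close>.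
\<close>
lemma chain_reach_intermediate:
  assumes "chain_reach K \<epsilon> a t r" "0 \<le> l" "l \<le> r" "0 \<le> \<epsilon>"
  shows "\<exists>z\<in>K. dist a z \<le> l \<and> dist z t \<le> r - l + \<epsilon>"
  using assms
proof (induction rule: chain_reach.induct)
  case start
  then show ?case by (intro bexI[of _ a]) auto
next
  case (step s r t)
  show ?case
  proof (cases "l \<le> r")
    case True
    then obtain z where "z \<in> K" "dist a z \<le> l" "dist z s \<le> r - l + \<epsilon>" using step by auto
    then show ?thesis using dist_triangle[of z t s] by (intro bexI[of _ z]) auto
  next
    case False
    then show ?thesis using chain_reach_dist[OF step.hyps(1)] step
      by (intro bexI[of _ s]) auto
  qed
qed

text \<open>
  The infimum \<open>u\<close> of the lengths of chains from \<open>a\<close>, truncated at \<open>M\<close>, increases by at most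
  \<open>dist s t\<close> from \<open>s\<close> to \<open>t\<close> when \<open>dist s t < \<epsilon>\<close>. By locality it is \<open>1\<close>-Lipschitz, hence \<open>u b \<le> dist a b < M\<close>, and the truncation
  cannot be the reason for this value.
\<close>
lemma daugavet_property_Lip_imp_short_chain:
  fixes K :: "'a::metric_space set"
  assumes K: "a \<in> K" "b \<in> K" "a \<noteq> b" and "compact K"
    and D: "daugavet_property (Lip K)" and \<epsilon>: "\<epsilon> > 0"
  obtains r where "chain_reach K \<epsilon> a b r" "r < dist a b + \<epsilon>"
proof -
  define M where "M = dist a b + \<epsilon>"
  have M: "M > 0" using \<epsilon> by (simp add: M_def add_nonneg_pos)
  \<comment> \<open>including \<open>M\<close> truncates the length and keeps the set nonempty where no chain arrives\<close>
  define R where "R t = insert M {r. chain_reach K \<epsilon> a t r}" for t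
  define u where "u = (\<lambda>t\<in>K. Inf (R t))"
  have bdd: "bdd_below (R t)" for t
    using chain_reach_nonneg M by (intro bdd_belowI[of _ 0]) (auto simp: R_def)
  have u0: "0 \<le> u t" "u t \<le> M" if "t \<in> K" for t
  proof -
    have "0 \<le> Inf (R t)" by (rule cInf_greatest) (use M chain_reach_nonneg in \<open>auto simp: R_def\<close>)
    moreover have "Inf (R t) \<le> M" by (rule cInf_lower[OF _ bdd]) (simp add: R_def)
    ultimately show "0 \<le> u t" "u t \<le> M" using that by (auto simp: u_def)
  qed
  have le: "u t \<le> u s + dist s t" if st: "s \<in> K" "t \<in> K" "dist s t < \<epsilon>" for s t
  proof -
    have "u t - dist s t \<le> Inf (R s)"
    proof (rule cInf_greatest)
      fix r assume "r \<in> R s"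
      then consider "r = M" | "chain_reach K \<epsilon> a s r" by (auto simp: R_def)
      then show "u t - dist s t \<le> r"
      proof cases
        case 1
        then show ?thesis using u0(2)[OF st(2)] zero_le_dist[of s t] by linarith
      next
        case 2
        then have "r + dist s t \<in> R t" using chain_reach.step[OF 2 st(2,3)] by (simp add: R_def)
        then have "u t \<le> r + dist s t" using cInf_lower[OF _ bdd] st(2) by (simp add: u_def)
        then show ?thesis by simp
      qed
    qed (simp add: R_def)
    then show ?thesis using st(1) by (simp add: u_def)
  qed
  have loc: "\<bar>u s - u t\<bar> \<le> dist s t" if "s \<in> K" "t \<in> K" "dist s t < \<epsilon>" for s t
    using le[of s t] le[of t s] that by (simp add: dist_commute abs_le_iff)
  have "u \<in> lip_funs K"
  proof (rule lip_funs_of_bound)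
    show "u \<in> extensional K" unfolding u_def by (rule restrict_extensional)
    fix s t assume st: "s \<in> K" "t \<in> K"
    \<comment> \<open>at distance at least \<open>\<epsilon>\<close> the values, which lie between \<open>0\<close> and \<open>M\<close>, give the bound\<close>
    show "\<bar>u s - u t\<bar> \<le> (1 + M / \<epsilon>) * dist s t"
    proof (cases "dist s t < \<epsilon>")
      case True
      have "0 \<le> M / \<epsilon> * dist s t" using M \<epsilon> by simp
      then show ?thesis using loc[OF st True] by (simp add: distrib_right)
    next
      case False
      then have "M / \<epsilon> * \<epsilon> \<le> M / \<epsilon> * dist s t" using M \<epsilon> by (intro mult_left_mono) auto
      then have "M \<le> M / \<epsilon> * dist s t" using \<epsilon> by simp
      then show ?thesis using u0[OF st(1)] u0[OF st(2)] zero_le_dist[of s t]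
        unfolding distrib_right abs_le_iff mult_1 by linarith
    qed
  qed
  then have "lip_seminorm K u \<le> 1" "\<bar>u b - u a\<bar> \<le> lip_seminorm K u * dist b a"
    using daugavet_property_Lip_imp_local[OF K \<open>compact K\<close> D _ \<epsilon> loc] lip_seminorm_quot_le K
    by auto
  then have "\<bar>u b - u a\<bar> \<le> dist b a"
    using mult_right_mono[of "lip_seminorm K u" 1 "dist b a"] by simp
  moreover have "u a \<le> 0"
    unfolding u_def using K(1) chain_reach.start[OF K(1)]
    by (auto simp: R_def intro!: cInf_lower bdd[unfolded R_def])
  ultimately have "Inf (R b) < M" using K(2) \<epsilon> by (simp add: u_def M_def dist_commute abs_le_iff)
  then obtain r where "r \<in> R b" "r < M" using cInf_lessD[of "R b" M] by (auto simp: R_def)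
  then show ?thesis using that by (auto simp: R_def M_def)
qed

lemma daugavet_property_Lip_imp_midpoint:
  fixes K :: "'a::metric_space set"
  assumes K: "a \<in> K" "b \<in> K" "a \<noteq> b" and "compact K"
    and D: "daugavet_property (Lip K)"
  obtains z where "z \<in> K" "dist a z \<le> dist a b / 2" "dist z b \<le> dist a b / 2"
proof -
  define d where "d = dist a b / 2"
  have "\<exists>z\<in>K. dist a z \<le> d \<and> dist z b \<le> d + 2 / real (Suc n)" for n
  proof -
    define \<epsilon> where "\<epsilon> = 1 / real (Suc n)"
    have \<epsilon>: "\<epsilon> > 0" by (simp add: \<epsilon>_def)
    obtain r where r: "chain_reach K \<epsilon> a b r" "r < dist a b + \<epsilon>"
      by (rule daugavet_property_Lip_imp_short_chain[OF K \<open>compact K\<close> D \<epsilon>])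
    have "d \<le> r"
      using chain_reach_dist[OF r(1)] zero_le_dist[of a b] unfolding d_def by linarith
    then obtain z where "z \<in> K" "dist a z \<le> d" "dist z b \<le> r - d + \<epsilon>"
      using chain_reach_intermediate[OF r(1), of d] \<epsilon> by (auto simp: d_def)
    moreover have "r - d + \<epsilon> \<le> d + 2 / real (Suc n)" using r(2) by (simp add: d_def \<epsilon>_def)
    ultimately show ?thesis by (intro bexI[of _ z]) auto
  qed
  then obtain x where x: "\<And>n. x n \<in> K \<and> dist a (x n) \<le> d \<and> dist (x n) b \<le> d + 2 / real (Suc n)"
    by metis
  obtain z \<phi> where z: "z \<in> K" "strict_mono \<phi>" "(x \<circ> \<phi>) \<longlonglongrightarrow> z"
    using seq_compactE[OF \<open>compact K\<close>[unfolded compact_eq_seq_compact_metric], of x] x by blast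
  have "dist a z \<le> d"
    by (rule LIMSEQ_le_const2[OF tendsto_dist[OF tendsto_const z(3)]]) (use x in auto)
  moreover have "dist z b \<le> d + 0"
  proof (rule LIMSEQ_le[OF tendsto_dist[OF z(3) tendsto_const]])
    have "(\<lambda>n. 2 / real (Suc n)) \<longlonglongrightarrow> 0"
      using tendsto_mult[OF tendsto_const[of 2] lim_inverse_n'[THEN LIMSEQ_Suc]] by simp
    then have "(\<lambda>n. d + 2 / real (Suc n)) \<longlonglongrightarrow> d + 0" by (intro tendsto_add tendsto_const)
    from LIMSEQ_subseq_LIMSEQ[OF this z(2)]
    show "(\<lambda>n. d + 2 / real (Suc (\<phi> n))) \<longlonglongrightarrow> d + 0" by (simp add: o_def)
  qed (use x in auto)
  ultimately show ?thesis using that z(1) by (simp add: d_def)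
qed

section \<open>Convexity from midpoints\<close>

text \<open>
  The vectors \<open>z - a\<close> and \<open>b - z\<close>, scaled to the unit ball, have a sum of norm \<open>2\<close>. Both are then unit
  vectors, and rotundity at the first, for every \<open>\<eta>\<close>, makes them equal.
\<close>
lemma locally_uniformly_rotund_imp_midpoint_unique:
  fixes a b z :: "'e::real_normed_vector"
  assumes lur: "locally_uniformly_rotund TYPE('e)" and "a \<noteq> b"
    and az: "dist a z \<le> dist a b / 2" and zb: "dist z b \<le> dist a b / 2"
  shows "z = (1/2) *\<^sub>R (a + b)"
proof -
  define d where "d = dist a b / 2"
  have d: "d > 0" using \<open>a \<noteq> b\<close> by (simp add: d_def)
  define x where "x = (1 / d) *\<^sub>R (z - a)"
  define y where "y = (1 / d) *\<^sub>R (b - z)"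
  have "norm x = dist a z / d" "norm y = dist z b / d"
    using d by (simp_all add: x_def y_def dist_norm norm_minus_commute)
  then have nx: "norm x \<le> 1" and ny: "norm y \<le> 1"
    using az[folded d_def] zb[folded d_def] d by simp_all
  have "x + y = (1 / d) *\<^sub>R ((z - a) + (b - z))"
    unfolding x_def y_def by (rule scaleR_add_right[symmetric])
  then have "norm (x + y) = dist a b / d"
    using d by (simp add: dist_norm norm_minus_commute)
  moreover have "dist a b = 2 * d" by (simp add: d_def)
  ultimately have xy: "norm (x + y) = 2" using d by simp
  then have "norm x = 1" using nx ny norm_triangle_ineq[of x y] by linarith
  have close: "norm (x - y) \<le> \<eta>" if \<eta>: "\<eta> > 0" for \<eta>
  proof -
    obtain \<delta> where "\<delta> > 0" and \<delta>: "\<And>y. norm y \<le> 1 \<and> norm ((1/2) *\<^sub>R (x + y)) \<ge> 1 - \<delta> \<Longrightarrow> norm (x - y) \<le> \<eta>"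
      using lur[unfolded locally_uniformly_rotund_def, rule_format, OF \<open>norm x = 1\<close> \<eta>] by blast
    then show ?thesis using ny xy by (intro \<delta>) simp
  qed
  have "norm (x - y) \<le> 0"
    by (rule field_le_epsilon) (simp only: add_0_left close)
  then have "x = y" by simp
  then have "z - a = b - z \<or> 1 / d = 0" unfolding x_def y_def scaleR_cancel_left .
  moreover have "1 / d \<noteq> 0" using d by simp
  ultimately have eq: "z - a = b - z" by blast
  have "a + b = a + ((b - z) + z)" by simp
  also have "\<dots> = a + ((z - a) + z)" by (simp only: eq)
  also have "\<dots> = z + z" by simp
  finally have "a + b = z + z" .
  then show ?thesis by simp
qed

text \<open>
  If the segment from \<open>a\<close> to \<open>b\<close> left \<open>K\<close> at some point, then the two points of \<open>K\<close> on the segment that are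
  next to it on either side would have their midpoint in \<open>K\<close>, between them.
\<close>
lemma convex_of_closed_midpoint:
  fixes K :: "'e::real_normed_vector set"
  assumes "closed K" and mid: "\<And>a b. \<lbrakk>a \<in> K; b \<in> K\<rbrakk> \<Longrightarrow> (1/2) *\<^sub>R (a + b) \<in> K"
  shows "convex K"
proof -
  have "(1 - c) *\<^sub>R a + c *\<^sub>R b \<in> K" if ab: "a \<in> K" "b \<in> K" and c: "0 \<le> c" "c \<le> 1" for a b c
  proof (rule ccontr)
    define \<gamma> where "\<gamma> t = (1 - t) *\<^sub>R a + t *\<^sub>R b" for t :: real
    define T where "T = \<gamma> -` K"
    assume "\<not> ?thesis"
    then have "c \<notin> T" by (simp add: T_def \<gamma>_def)
    have "closed T"
      unfolding T_def \<gamma>_def by (intro closed_vimage \<open>closed K\<close> continuous_on_add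
          continuous_on_scaleR continuous_on_diff continuous_on_const continuous_on_id)
    then have "compact ({0..c} \<inter> T)" "compact ({c..1} \<inter> T)" by (auto intro: compact_Int_closed)
    moreover have "0 \<in> {0..c} \<inter> T" "1 \<in> {c..1} \<inter> T" using ab c by (auto simp: T_def \<gamma>_def)
    ultimately have "\<exists>l\<in>{0..c} \<inter> T. \<forall>t\<in>{0..c} \<inter> T. t \<le> l" "\<exists>r\<in>{c..1} \<inter> T. \<forall>t\<in>{c..1} \<inter> T. r \<le> t"
      by (intro compact_attains_sup compact_attains_inf; blast)+
    then obtain l r where l: "l \<in> {0..c} \<inter> T" "\<And>t. t \<in> {0..c} \<inter> T \<Longrightarrow> t \<le> l"
      and r: "r \<in> {c..1} \<inter> T" "\<And>t. t \<in> {c..1} \<inter> T \<Longrightarrow> r \<le> t" by blast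
    have "l < c" "c < r" using l(1) r(1) \<open>c \<notin> T\<close> by (auto simp: less_le)
    define m where "m = (l + r) / 2"
    have m2: "2 * m = l + r" by (simp add: m_def)
    have eq: "\<gamma> t = a + t *\<^sub>R (b - a)" for t by (simp add: \<gamma>_def algebra_simps)
    have "\<gamma> l + \<gamma> r = 2 *\<^sub>R a + (l + r) *\<^sub>R (b - a)"
      by (simp only: eq scaleR_2 scaleR_add_left add_ac)
    also have "\<dots> = 2 *\<^sub>R \<gamma> m" by (simp only: eq scaleR_add_right scaleR_scaleR m2)
    finally have "\<gamma> m = (1/2) *\<^sub>R (\<gamma> l + \<gamma> r)" by simp
    then have "m \<in> T" using mid[of "\<gamma> l" "\<gamma> r"] l(1) r(1) by (simp add: T_def)
    then have "m \<le> l \<or> r \<le> m"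
      using l(2)[of m] r(2)[of m] l(1) r(1) m2 by (cases "m \<le> c") auto
    then show False using \<open>l < c\<close> \<open>c < r\<close> by (auto simp: m_def)
  qed
  then show ?thesis by (simp add: convex_alt)
qed

theorem corollary3p4:
  fixes K :: "'e::banach set"
  assumes "smooth_space TYPE('e)"
    and "locally_uniformly_rotund TYPE('e)"
    and "compact K"
    and "K \<noteq> {}"
    and "\<not> is_singleton K"
  shows "daugavet_property (Lip K) \<longleftrightarrow> convex K"
proof -
  obtain s0 t0 where K: "s0 \<in> K" "t0 \<in> K" "s0 \<noteq> t0"
    using assms(4,5) is_singletonI'[of K] by blast
  show ?thesis
  proof
    assume D: "daugavet_property (Lip K)"
    show "convex K"
    proof (rule convex_of_closed_midpoint)
      show "closed K" by (rule compact_imp_closed[OF assms(3)])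
      fix a b assume ab: "a \<in> K" "b \<in> K"
      show "(1/2) *\<^sub>R (a + b) \<in> K"
      proof (cases "a = b")
        case True
        then show ?thesis using ab by simp
      next
        case False
        obtain z where z: "z \<in> K" "dist a z \<le> dist a b / 2" "dist z b \<le> dist a b / 2"
          by (rule daugavet_property_Lip_imp_midpoint[OF ab False assms(3) D])
        then show ?thesis
          using locally_uniformly_rotund_imp_midpoint_unique[OF assms(2) False z(2,3)] by simp
      qed
    qed
  next
    assume "convex K"
    then show "daugavet_property (Lip K)" by (rule convex_imp_daugavet_property_Lip[OF K])
  qed
qed

end
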